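(* Assume: ($H_1$) the system $\frac{d}{dt}y=Ay+Bu$ is smoothly controllable in time $T_0$ for some $T_0>0$; ($H_2$) $\mathscr{U}_{ad}\subset U$ is a closed and convex cone with vertex at $0$ and $\mathrm{int}^V(\mathscr{U}_{ad}\cap V)\neq\varnothing$, where $\mathrm{int}^V$ denotes the interior in the topology of $V$. Set $$\mathscr{W}=\mathrm{int}^V(\mathscr{U}_{ad}\cap V)+\mathscr{U}_{ad}.$$ Let $(y_0,\overline{u}^0),(y_1,\overline{u}^1)\in H\times\mathscr{W}$ satisfy $$Ay_i+B\overline{u}^i=0,\qquad i=0,1.$$ Then there exist $T>T_0$ and $u\in L^2(0,T;U)$ such that $u(t)\in\mathscr{U}_{ad}$ for a.e. $t\in(0,T)$ and $y(T;y_0,u)=y_1$.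
   Context: Abstract setting. $H$ (state space) and $U$ (control space) are real Hilbert spaces. $A:D(A)\subset H\to H$ generates a $C_0$-semigroup $(\mathbb{T}_t)_{t\ge0}$ on $H$. $H_{-1}$ is the completion of $H$ for the norm $\|(\beta I-A)^{-1}\cdot\|_H$, where $\beta$ is real and $\beta I-A$ is invertible with continuous inverse on $H$ (the space does not depend on $\beta$); $A$ extends uniquely to a bounded operator $H\to H_{-1}$, still denoted $A$, and the semigroup extends to $H_{-1}$. The control operator $B\in\mathscr{L}(U,H_{-1})$ is assumed admissible: for all $\tau>0$ and all $u\in L^2((0,+\infty);U)$, $\int_0^\tau\mathbb{T}_{\tau-r}Bu(r)\,dr\in H$. For $y_0\in H$ and $u\in L^2_{loc}([0,+\infty);U)$, $y(\cdot;y_0,u)\in C^0([0,+\infty);H)$ denotes the unique mild solution of $\frac{d}{dt}y(t)=Ay(t)+Bu(t)$, $y(0)=y_0$, namely $y(t)=\mathbb{T}_ty_0+\int_0^t\mathbb{T}_{t-r}Bu(r)\,dr$ (for controls defined on $(0,T)$ only, the solution is considered on $[0,T]$). The equation $Ay_i+B\overline{u}^i=0$ is understood in $H_{-1}$. Fix $s\in\mathbb{N}$ and a Hilbert space $V$ continuously embedded in $U$. $D(A^s)$ carries the norm $\|x\|_{D(A^s)}^2=\sum_{j=0}^s\|A^jx\|_H^2$. Smooth controllability: the system is smoothly controllable in time $T_0>0$ if there is a constant $C$ such that for every $y_0\in D(A^s)$ there exists $v\in L^\infty((0,T_0);V)$ with $y(T_0;y_0,v)=0$ and $\|v\|_{L^\infty((0,T_0);V)}\le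 C\|y_0\|_{D(A^s)}$, $C$ being independent of $y_0$. *)

theory Defs
  imports "HOL-Analysis.Analysis"
begin

section \<open>Semigroups and generators\<close>

definition C0_semigroup :: "(real \<Rightarrow> 'h::real_normed_vector \<Rightarrow> 'h) \<Rightarrow> bool" where
  "C0_semigroup S \<longleftrightarrow>
     (\<forall>t\<ge>0. bounded_linear (S t)) \<and>
     (\<forall>x. S 0 x = x) \<and>
     (\<forall>s\<ge>0. \<forall>t\<ge>0. \<forall>x. S (s + t) x = S s (S t x)) \<and>
     (\<forall>x. ((\<lambda>t. S t x) \<longlongrightarrow> x) (at_right 0))"

text \<open>An unbounded operator is a pair of its domain \<open>D\<close> and a total function \<open>A\<close>, whose values
  outside \<open>D\<close> are never used.\<close>

definition generates ::
  "'h::real_normed_vector set \<Rightarrow> ('h \<Rightarrow> 'h) \<Rightarrow> (real \<Rightarrow> 'h \<Rightarrow> 'h) \<Rightarrow> bool" where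
  "generates D A S \<longleftrightarrow>
     C0_semigroup S \<and>
     D = {x. \<exists>z. ((\<lambda>t. (S t x - x) /\<^sub>R t) \<longlongrightarrow> z) (at_right 0)} \<and>
     (\<forall>x\<in>D. ((\<lambda>t. (S t x - x) /\<^sub>R t) \<longlongrightarrow> A x) (at_right 0))"

definition domain_power :: "'h set \<Rightarrow> ('h \<Rightarrow> 'h) \<Rightarrow> nat \<Rightarrow> 'h set" where
  "domain_power D A s = {x. \<forall>j<s. (A ^^ j) x \<in> D}"

definition graph_norm :: "('h::real_normed_vector \<Rightarrow> 'h) \<Rightarrow> nat \<Rightarrow> 'h \<Rightarrow> real" where
  "graph_norm A s x = sqrt (\<Sum>j\<le>s. (norm ((A ^^ j) x))\<^sup>2)"

section \<open>The extrapolation space\<close>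

definition resolvent ::
  "'h::real_normed_vector set \<Rightarrow> ('h \<Rightarrow> 'h) \<Rightarrow> real \<Rightarrow> 'h \<Rightarrow> 'h" where
  "resolvent D A \<beta> = inv_into D (\<lambda>x. \<beta> *\<^sub>R x - A x)"

definition in_resolvent_set ::
  "'h::real_normed_vector set \<Rightarrow> ('h \<Rightarrow> 'h) \<Rightarrow> real \<Rightarrow> bool" where
  "in_resolvent_set D A \<beta> \<longleftrightarrow>
     bij_betw (\<lambda>x. \<beta> *\<^sub>R x - A x) D UNIV \<and> bounded_linear (resolvent D A \<beta>)"

text \<open>The Banach space \<open>'m\<close>, together with the embedding \<open>\<iota>\<close>, is a completion of \<open>'h\<close> for the norm
  \<open>x \<mapsto> \<parallel>(\<beta>I - A)\<inverse> x\<parallel>\<close>; completions being unique up to isometric isomorphism, any such pair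
  is a model of the space \<open>H\<^sub>-\<^sub>1\<close>.\<close>

definition extrapolation_space ::
  "'h::real_normed_vector set \<Rightarrow> ('h \<Rightarrow> 'h) \<Rightarrow> real \<Rightarrow> ('h \<Rightarrow> 'm::banach) \<Rightarrow> bool" where
  "extrapolation_space D A \<beta> \<iota> \<longleftrightarrow>
     linear \<iota> \<and> (\<forall>x. norm (\<iota> x) = norm (resolvent D A \<beta> x)) \<and> closure (range \<iota>) = UNIV"

text \<open>The unique bounded linear \<open>g\<close> with \<open>g \<circ> e = f\<close> on \<open>D\<close>. It is used only where \<open>e ` D\<close> is dense
  and such a \<open>g\<close> exists.\<close>

definition bounded_extension ::
  "('x \<Rightarrow> 'a::real_normed_vector) \<Rightarrow> 'x set \<Rightarrow> ('x \<Rightarrow> 'b::real_normed_vector) \<Rightarrow> 'a \<Rightarrow> 'b" where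
  "bounded_extension e D f = (THE g. bounded_linear g \<and> (\<forall>x\<in>D. g (e x) = f x))"

definition generator_ext ::
  "'h::real_normed_vector set \<Rightarrow> ('h \<Rightarrow> 'h) \<Rightarrow> ('h \<Rightarrow> 'm::banach) \<Rightarrow> 'h \<Rightarrow> 'm" where
  "generator_ext D A \<iota> = bounded_extension (\<lambda>x. x) D (\<lambda>x. \<iota> (A x))"

definition semigroup_ext ::
  "(real \<Rightarrow> 'h::real_normed_vector \<Rightarrow> 'h) \<Rightarrow> ('h \<Rightarrow> 'm::banach) \<Rightarrow> real \<Rightarrow> 'm \<Rightarrow> 'm" where
  "semigroup_ext S \<iota> t = bounded_extension \<iota> UNIV (\<lambda>x. \<iota> (S t x))"

section \<open>Vector-valued Lebesgue spaces\<close>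

text \<open>The Bochner integral of the library is restricted to separable spaces. Here \<^const>\<open>measurable_on\<close>
  (being an almost everywhere limit of continuous functions) is strong measurability, without any
  separability of the target space, and the Henstock-Kurzweil \<^const>\<open>integral\<close> agrees with the
  Bochner integral on strongly measurable functions with integrable norm.\<close>

definition L2 :: "real set \<Rightarrow> (real \<Rightarrow> 'a::real_normed_vector) set" where
  "L2 I = {u. u measurable_on I \<and> set_integrable lebesgue I (\<lambda>t. (norm (u t))\<^sup>2)}"

definition Linf :: "real set \<Rightarrow> (real \<Rightarrow> 'a::real_normed_vector) set" where
  "Linf I = {v. v measurable_on I \<and> (\<exists>M. AE t in lebesgue_on I. norm (v t) \<le> M)}"

definition Linf_norm :: "real set \<Rightarrow> (real \<Rightarrow> 'a::real_normed_vector) \<Rightarrow> real" where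
  "Linf_norm I v = Inf {M. 0 \<le> M \<and> (AE t in lebesgue_on I. norm (v t) \<le> M)}"

section \<open>The control system\<close>

definition input_map ::
  "(real \<Rightarrow> 'h::real_normed_vector \<Rightarrow> 'h) \<Rightarrow> ('h \<Rightarrow> 'm::banach) \<Rightarrow> ('u \<Rightarrow> 'm)
     \<Rightarrow> (real \<Rightarrow> 'u) \<Rightarrow> real \<Rightarrow> 'm" where
  "input_map S \<iota> B u t = integral {0..t} (\<lambda>r. semigroup_ext S \<iota> (t - r) (B (u r)))"

definition admissible ::
  "(real \<Rightarrow> 'h::real_normed_vector \<Rightarrow> 'h) \<Rightarrow> ('h \<Rightarrow> 'm::banach)
     \<Rightarrow> ('u::real_normed_vector \<Rightarrow> 'm) \<Rightarrow> bool" where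
  "admissible S \<iota> B \<longleftrightarrow> (\<forall>\<tau>>0. \<forall>u\<in>L2 {0<..}. input_map S \<iota> B u \<tau> \<in> range \<iota>)"

text \<open>The variation-of-constants formula holds in \<open>'m\<close>; admissibility ensures that its right-hand
  side is the image of a (unique) element of \<open>'h\<close>.\<close>

definition mild_solution ::
  "(real \<Rightarrow> 'h::real_normed_vector \<Rightarrow> 'h) \<Rightarrow> ('h \<Rightarrow> 'm::banach) \<Rightarrow> ('u \<Rightarrow> 'm)
     \<Rightarrow> 'h \<Rightarrow> (real \<Rightarrow> 'u) \<Rightarrow> real \<Rightarrow> 'h" where
  "mild_solution S \<iota> B y0 u t = (THE y. \<iota> y = \<iota> (S t y0) + input_map S \<iota> B u t)"

text \<open>The map \<open>j\<close> is the embedding of the space \<open>'v\<close> of smooth controls into the control space.\<close>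

definition smoothly_controllable ::
  "('h::real_normed_vector \<Rightarrow> 'h) \<Rightarrow> 'h set \<Rightarrow> (real \<Rightarrow> 'h \<Rightarrow> 'h) \<Rightarrow> ('h \<Rightarrow> 'm::banach)
     \<Rightarrow> ('u \<Rightarrow> 'm) \<Rightarrow> ('v::real_normed_vector \<Rightarrow> 'u) \<Rightarrow> nat \<Rightarrow> real \<Rightarrow> bool" where
  "smoothly_controllable A D S \<iota> B j s T0 \<longleftrightarrow>
     (\<exists>C. \<forall>y0 \<in> domain_power D A s. \<exists>v \<in> Linf {0<..<T0}.
        mild_solution S \<iota> B y0 (\<lambda>t. j (v t)) T0 = 0 \<and>
        Linf_norm {0<..<T0} v \<le> C * graph_norm A s y0)"

end

theory Submission
  imports Defs
begin

text \<open>
  \<^bold>\<open>The control argument.\<close> Put \<open>x = y0 - y1\<close> and \<open>d = u0 - u1\<close>, so that \<open>A x + B d = 0\<close>. A single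
  control \<open>c\<close> of duration \<open>1 + T0\<close>, subject to no constraint, drives \<open>x\<close> to \<open>0\<close>. During the first
  unit of time it is \<open>\<rho>(t) d\<close>, with \<open>\<rho>\<close> falling from \<open>1\<close> to \<open>0\<close>; integration by parts shows that it
  leads to \<open>\<integral> \<phi>(r) S(r) x dr\<close> with \<open>\<phi>(r) = - \<rho>'(1 - r)\<close>, and this average of the orbit lies in the domain
  of \<open>A^s\<close> as soon as \<open>\<phi>\<close> vanishes to order \<open>s\<close> at both ends (\<open>smoothing_control\<close>). Smooth controllability
  takes over from there with a bounded control \<open>j w\<close> (\<open>smooth_null_control\<close>).

  By linearity \<open>c / n\<close> drives \<open>x / n\<close> to \<open>0\<close>. Now divide the segment from \<open>y0\<close> to \<open>y1\<close> into \<open>n\<close> equal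
  pieces by points \<open>Y k\<close>, which are steady states for controls on the segment from \<open>u0\<close> to \<open>u1\<close>. Adding
  \<open>c / n\<close> to the constant control that holds \<open>Y (k + 1)\<close> steers \<open>Y k\<close> to \<open>Y (k + 1)\<close>. In the first phase
  this control remains on the segment from \<open>u0\<close> to \<open>u1\<close>, hence in the cone. In the second phase it
  deviates from the segment by \<open>j w / n\<close>; because \<open>u0\<close> and \<open>u1\<close> lie in \<open>W\<close>, a whole neighbourhood of the
  segment in the direction of the smooth controls is contained in the cone, so large \<open>n\<close> suffices
  (\<open>steer_along_segment\<close>). Concatenating the \<open>n\<close> pieces gives the control of the theorem.

  \<^bold>\<open>Working in the state space.\<close> With \<open>R = (\<beta> - A)\<^sup>-\<^sup>1\<close>, the map \<open>R x \<mapsto> \<iota> x\<close> is isometric, and it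
  extends to an isometry \<open>K\<close> of \<open>H\<close> onto the extrapolation space. It conjugates the extended semigroup
  to \<open>S\<close>, so with \<open>b = K\<^sup>-\<^sup>1 B\<close> the variation-of-constants formula becomes
  \<open>R y(t) = S(t) R y0 + \<integral> S(t - r) b u(r) dr\<close>, an identity in \<open>H\<close> with a bounded control operator. The
  predicate \<open>steers\<close> records it, and superposition, concatenation and the behaviour of steady states
  are read off from it. A steady state is then \<open>A (R y) + b u = 0\<close>, with \<open>R y\<close> in the domain of \<open>A\<close>.
\<close>

section \<open>Integration of bounded strongly measurable functions\<close>

text \<open>A tag-wise bound on \<open>f - g\<close> passes to Riemann sums: those of \<open>f\<close> differ from those of \<open>g\<close> by
  at most the Riemann sums of \<open>h\<close>, which are close to the small integral of \<open>h\<close>. Hence the Riemann sums of \<open>f\<close>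
  inherit the Cauchy property. Only the scalar function \<open>h\<close> needs integration theory beyond
  Riemann sums, so \<open>f\<close> may take values in any Banach space.\<close>
lemma integrable_approx:
  fixes f :: "'n::euclidean_space \<Rightarrow> 'b::banach"
  assumes approx: "\<And>e. e > 0 \<Longrightarrow> \<exists>g h. g integrable_on cbox a b \<and> h integrable_on cbox a b \<and>
      (\<forall>t\<in>cbox a b. norm (f t - g t) \<le> h t) \<and> integral (cbox a b) h < (e::real)"
  shows "f integrable_on cbox a b"
  unfolding integrable_Cauchy
proof (intro allI impI)
  fix e :: real assume "e > 0"
  then obtain g h where g: "g integrable_on cbox a b" and h: "h integrable_on cbox a b"
    and fg: "\<And>t. t \<in> cbox a b \<Longrightarrow> norm (f t - g t) \<le> h t" and small: "integral (cbox a b) h < e/6"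
    using approx[of "e/6"] by auto
  define S where "S F \<D> = (\<Sum>(x,K)\<in>\<D>. measure lborel K *\<^sub>R F x)" for F :: "'n \<Rightarrow> 'b" and \<D> :: "('n \<times> 'n set) set"
  obtain \<gamma> where \<gamma>: "gauge \<gamma>"
    and Sg: "\<And>\<D>1 \<D>2. \<D>1 tagged_division_of cbox a b \<Longrightarrow> \<gamma> fine \<D>1 \<Longrightarrow>
        \<D>2 tagged_division_of cbox a b \<Longrightarrow> \<gamma> fine \<D>2 \<Longrightarrow> norm (S g \<D>1 - S g \<D>2) < e/3"
    using g[unfolded integrable_Cauchy, rule_format, of "e/3"] \<open>e > 0\<close> unfolding S_def by auto
  obtain \<delta> where \<delta>: "gauge \<delta>"
    and Sh: "\<And>\<D>. \<D> tagged_division_of cbox a b \<Longrightarrow> \<delta> fine \<D> \<Longrightarrow>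
        norm ((\<Sum>(x,K)\<in>\<D>. measure lborel K *\<^sub>R h x) - integral (cbox a b) h) < e/6"
    using integrable_integral[OF h, unfolded has_integral, rule_format, of "e/6"] \<open>e > 0\<close> by auto
  have S_fg: "norm (S f \<D> - S g \<D>) < e/3" if "\<D> tagged_division_of cbox a b" "\<delta> fine \<D>" for \<D>
  proof -
    have "S f \<D> - S g \<D> = (\<Sum>(x,K)\<in>\<D>. measure lborel K *\<^sub>R (f x - g x))"
      by (simp add: S_def sum_subtractf[symmetric] scaleR_diff_right case_prod_unfold)
    also have "norm \<dots> \<le> (\<Sum>(x,K)\<in>\<D>. measure lborel K *\<^sub>R h x)"
      using tag_in_interval[OF that(1)]
      by (intro sum_norm_le) (auto intro!: mult_left_mono fg)
    also have "\<dots> < e/3"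
      using Sh[OF that] small unfolding real_norm_def by linarith
    finally show ?thesis .
  qed
  have "norm (S f \<D>1 - S f \<D>2) < e"
    if "\<D>1 tagged_division_of cbox a b" "(\<lambda>x. \<gamma> x \<inter> \<delta> x) fine \<D>1"
       "\<D>2 tagged_division_of cbox a b" "(\<lambda>x. \<gamma> x \<inter> \<delta> x) fine \<D>2" for \<D>1 \<D>2
  proof -
    have "norm (S f \<D>1 - S g \<D>1) < e/3" "norm (S f \<D>2 - S g \<D>2) < e/3" "norm (S g \<D>1 - S g \<D>2) < e/3"
      using S_fg[OF that(1)] S_fg[OF that(3)] Sg[OF that(1) _ that(3)] that(2,4) by (simp_all add: fine_Int)
    moreover have "norm (S f \<D>1 - S f \<D>2) =
        norm ((S f \<D>1 - S g \<D>1) - (S f \<D>2 - S g \<D>2) + (S g \<D>1 - S g \<D>2))"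
      by simp
    ultimately show ?thesis
      using norm_triangle_ineq[of "(S f \<D>1 - S g \<D>1) - (S f \<D>2 - S g \<D>2)" "S g \<D>1 - S g \<D>2"]
        norm_triangle_ineq4[of "S f \<D>1 - S g \<D>1" "S f \<D>2 - S g \<D>2"] by linarith
  qed
  then show "\<exists>\<gamma>. gauge \<gamma> \<and> (\<forall>\<D>1 \<D>2. \<D>1 tagged_division_of cbox a b \<and> \<gamma> fine \<D>1 \<and>
      \<D>2 tagged_division_of cbox a b \<and> \<gamma> fine \<D>2 \<longrightarrow>
      norm ((\<Sum>(x,K)\<in>\<D>1. measure lborel K *\<^sub>R f x) - (\<Sum>(x,K)\<in>\<D>2. measure lborel K *\<^sub>R f x)) < e)"
    unfolding S_def by (intro exI[of _ "\<lambda>x. \<gamma> x \<inter> \<delta> x"] conjI gauge_Int[OF \<gamma> \<delta>] allI impI) simp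
qed

text \<open>The continuous functions that converge to \<open>f\<close> almost everywhere can be truncated to the ball that
  contains the values of \<open>f\<close>. Dominated convergence for the scalar functions \<open>\<parallel>f - G n\<parallel>\<close> then
  makes their integrals tend to \<open>0\<close>, so that the approximation criterion applies.\<close>
lemma bounded_measurable_integrable:
  fixes f :: "real \<Rightarrow> 'b::banach"
  assumes meas: "f measurable_on {a..b}" and bound: "\<And>t. t \<in> {a..b} \<Longrightarrow> norm (f t) \<le> M"
  shows "f integrable_on {a..b}"
proof -
  define L where "L = max M 1"
  have "L > 0" by (simp add: L_def)
  obtain N g where "negligible N" and cont: "\<And>n. continuous_on UNIV (g n)"
    and lim: "\<And>x. x \<notin> N \<Longrightarrow> (\<lambda>n::nat. g n x) \<longlonglongrightarrow> (if x \<in> {a..b} then f x else 0)"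
    using meas unfolding measurable_on_def by auto
  \<comment> \<open>The radial retraction onto the ball of radius \<open>L\<close>; it is continuous because \<open>L > 0\<close>.\<close>
  define trunc where "trunc z = (L / max L (norm z)) *\<^sub>R z" for z :: 'b
  have trunc_cont: "continuous_on UNIV trunc"
    unfolding trunc_def using \<open>L > 0\<close> by (intro continuous_intros) (auto simp: max_def)
  have trunc_le: "norm (trunc z) \<le> L" for z
    using \<open>L > 0\<close> by (auto simp: trunc_def max_def field_simps)
  have trunc_id: "trunc z = z" if "norm z \<le> L" for z
    using that \<open>L > 0\<close> by (auto simp: trunc_def max_def)
  \<comment> \<open>Modified on \<open>N\<close> so that convergence holds at every point of the interval.\<close>
  define G where "G n t = (if t \<in> N then 0 else trunc (g n t))" for n t
  define f' where "f' t = (if t \<in> N then 0 else f t)" for t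
  have lim': "(\<lambda>n. G n t) \<longlonglongrightarrow> f' t" if t: "t \<in> {a..b}" for t
  proof (cases "t \<in> N")
    case False
    have "(\<lambda>n. trunc (g n t)) \<longlonglongrightarrow> trunc (f t)"
      using trunc_cont lim[OF False] t by (auto simp: continuous_on_def intro: tendsto_compose)
    moreover have "norm (f t) \<le> L" using bound[OF t] by (simp add: L_def)
    ultimately show ?thesis using False by (simp add: G_def f'_def trunc_id)
  qed (simp add: G_def f'_def)
  have G_le: "norm (G n t) \<le> L" for n t using trunc_le \<open>L > 0\<close> by (simp add: G_def)
  have f'_le: "norm (f' t) \<le> L" if "t \<in> {a..b}" for t
    using bound[OF that] by (auto simp: f'_def L_def)
  have cont_trunc: "continuous_on {a..b} (\<lambda>t. trunc (g n t))" for n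
    using continuous_on_compose2[OF trunc_cont cont] continuous_on_subset by blast
  have G_int: "G n integrable_on {a..b}" for n
    by (rule integrable_spike[OF integrable_continuous_real[OF cont_trunc[of n]] \<open>negligible N\<close>])
       (simp add: G_def)
  have GG_int: "(\<lambda>t. norm (G m t - G n t)) integrable_on {a..b}" for m n
    by (rule integrable_spike[OF integrable_continuous_real[OF
          continuous_on_norm[OF continuous_on_diff[OF cont_trunc[of m] cont_trunc[of n]]]] \<open>negligible N\<close>])
       (simp add: G_def)
  have const: "(\<lambda>t. 2 * L) integrable_on {a..b}" by (intro integrable_continuous_real continuous_intros)
  \<comment> \<open>\<open>\<parallel>f' - G n\<parallel>\<close> is itself the pointwise limit in \<open>m\<close> of the integrable functions \<open>\<parallel>G m - G n\<parallel>\<close>.\<close>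
  have h_int: "(\<lambda>t. norm (f' t - G n t)) integrable_on {a..b}" for n
  proof (rule dominated_convergence(1)[OF GG_int const])
    show "norm (norm (G m t - G n t)) \<le> 2 * L" for m t
      using norm_triangle_ineq4[of "G m t" "G n t"] G_le[of m t] G_le[of n t] by simp
    show "(\<lambda>k. norm (G k t - G n t)) \<longlonglongrightarrow> norm (f' t - G n t)" if "t \<in> {a..b}" for t
      by (intro tendsto_intros lim' that)
  qed
  have "(\<lambda>n. integral {a..b} (\<lambda>t. norm (f' t - G n t))) \<longlonglongrightarrow> integral {a..b} (\<lambda>t. 0)"
  proof (rule dominated_convergence(2)[OF h_int const])
    show "norm (norm (f' t - G m t)) \<le> 2 * L" if "t \<in> {a..b}" for m t
      using norm_triangle_ineq4[of "f' t" "G m t"] G_le[of m t] f'_le[OF that] by simp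
    show "(\<lambda>k. norm (f' t - G k t)) \<longlonglongrightarrow> 0" if "t \<in> {a..b}" for t
      using tendsto_norm[OF tendsto_diff[OF tendsto_const lim'[OF that]], of "f' t"] by simp
  qed
  then have to0: "(\<lambda>n. integral {a..b} (\<lambda>t. norm (f' t - G n t))) \<longlonglongrightarrow> 0" by simp
  have "f' integrable_on cbox a b"
  proof (rule integrable_approx)
    fix e :: real assume "e > 0"
    then obtain n where "integral {a..b} (\<lambda>t. norm (f' t - G n t)) < e"
      using order_tendstoD(2)[OF to0] by (auto simp: eventually_sequentially)
    then show "\<exists>g h. g integrable_on cbox a b \<and> h integrable_on cbox a b \<and>
        (\<forall>t\<in>cbox a b. norm (f' t - g t) \<le> h t) \<and> integral (cbox a b) h < e"
      using G_int h_int by (intro exI[of _ "G n"] exI[of _ "\<lambda>t. norm (f' t - G n t)"]) auto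
  qed
  then show ?thesis
    using integrable_spike[of f' "{a..b}" N f] \<open>negligible N\<close> by (simp add: f'_def)
qed

lemma has_integral_reverse:
  fixes f :: "real \<Rightarrow> 'a::real_normed_vector"
  assumes "(f has_integral I) {0..t}"
  shows "((\<lambda>r. f (t - r)) has_integral I) {0..t}"
proof -
  have "((\<lambda>r. f (- r)) has_integral I) {- t..0}"
    using assms has_integral_reflect_real[of f I t 0] by simp
  from has_integral_shift_real_ivl[OF this, of "- t"] show ?thesis by simp
qed

definition bounded_measurable :: "(real \<Rightarrow> 'a::real_normed_vector) \<Rightarrow> bool" where
  "bounded_measurable u \<longleftrightarrow> u measurable_on UNIV \<and> bounded (range u)"

lemma bounded_measurable_const: "bounded_measurable (\<lambda>t. c)"
  by (auto simp: bounded_measurable_def intro: measurable_on_const_UNIV)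

lemma bounded_measurable_add:
  assumes "bounded_measurable u" "bounded_measurable v"
  shows "bounded_measurable (\<lambda>t. u t + v t)"
  using assms bounded_plus_comp[of u UNIV v] by (auto simp: bounded_measurable_def intro: measurable_on_add)

lemma bounded_measurable_linear:
  assumes "bounded_linear f" "bounded_measurable u"
  shows "bounded_measurable (\<lambda>t. f (u t))"
  using assms measurable_on_compose_continuous[of u f] bounded_linear_image[of "range u" f]
  by (auto simp: bounded_measurable_def o_def image_image linear_continuous_on)

lemma bounded_measurable_shift:
  fixes u :: "real \<Rightarrow> 'a::real_normed_vector"
  assumes "bounded_measurable u"
  shows "bounded_measurable (\<lambda>t. u (t - a))"
proof -
  obtain N g where N: "negligible N" and cont: "\<And>n. continuous_on UNIV (g n)"
    and lim: "\<And>x. x \<notin> N \<Longrightarrow> (\<lambda>n::nat. g n x) \<longlonglongrightarrow> u x"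
    using assms unfolding bounded_measurable_def measurable_on_def by auto
  have "(\<lambda>t. u (t - a)) measurable_on UNIV"
    unfolding measurable_on_def
  proof (intro exI conjI allI impI)
    show "negligible ((+) a ` N)" using N by (rule negligible_translation)
    show "continuous_on UNIV (\<lambda>t. g n (t - a))" for n
      by (rule continuous_on_compose2[OF cont]) (auto intro: continuous_intros)
    show "(\<lambda>n. g n (t - a)) \<longlonglongrightarrow> (if t \<in> UNIV then u (t - a) else 0)" if "t \<notin> (+) a ` N" for t
      using lim[of "t - a"] that by (force simp: image_iff)
  qed
  then show ?thesis
    using assms by (auto simp: bounded_measurable_def intro: bounded_subset)
qed

lemma bounded_measurable_If:
  assumes "bounded_measurable u" "bounded_measurable v" "E \<in> sets lebesgue"
  shows "bounded_measurable (\<lambda>t. if t \<in> E then u t else v t)"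
proof -
  have "- E \<in> sets lebesgue" using assms(3) by (metis Compl_in_sets_lebesgue)
  then have "(\<lambda>t. (if t \<in> E then u t else 0) + (if t \<in> - E then v t else 0)) measurable_on UNIV"
    using assms by (intro measurable_on_add measurable_on_restrict) (auto simp: bounded_measurable_def)
  moreover have "(\<lambda>t. (if t \<in> E then u t else 0) + (if t \<in> - E then v t else 0)) = (\<lambda>t. if t \<in> E then u t else v t)"
    by auto
  moreover have "bounded (range (\<lambda>t. if t \<in> E then u t else v t))"
    using assms by (auto intro: bounded_subset[of "range u \<union> range v"] simp: bounded_measurable_def)
  ultimately show ?thesis by (simp add: bounded_measurable_def)
qed

text \<open>The set \<open>F\<close> of finite measure carries the function, which makes the boundedness sufficient; with
  \<open>E\<close> a half-line this covers controls that are switched off after a finite time.\<close>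
lemma bounded_measurable_L2:
  assumes "bounded_measurable u" "E \<in> sets lebesgue" "F \<in> lmeasurable" "F \<subseteq> E"
    and vanish: "\<And>t. t \<in> E - F \<Longrightarrow> u t = 0"
  shows "u \<in> L2 E"
proof -
  have F: "F \<in> sets lebesgue" using assms(3) by auto
  have um: "u measurable_on X" if "X \<in> sets lebesgue" for X
    using measurable_on_restrict[OF _ that, of u] assms(1) by (simp add: bounded_measurable_def measurable_on_UNIV)
  obtain M where M: "\<And>t. norm (u t) \<le> M"
    using assms(1) by (auto simp: bounded_measurable_def bounded_iff)
  have "(\<lambda>t. (norm (u t))\<^sup>2) measurable_on F"
    using measurable_on_compose_continuous_0[OF um[OF F], of "\<lambda>z. (norm z)\<^sup>2"]
    by (auto simp: o_def intro!: continuous_intros)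
  then have meas: "(\<lambda>t. (norm (u t))\<^sup>2) \<in> borel_measurable (lebesgue_on F)"
    using measurable_on_imp_borel_measurable_lebesgue F by blast
  have "(\<lambda>t. (norm (u t))\<^sup>2) absolutely_integrable_on F"
    using measurable_bounded_by_integrable_imp_absolutely_integrable
      [OF meas F, of "\<lambda>t. M\<^sup>2"] M assms(3) by (auto simp: integrable_on_const power_mono)
  moreover have "(\<lambda>t. indicator E t *\<^sub>R (norm (u t))\<^sup>2) = (\<lambda>t. indicator F t *\<^sub>R (norm (u t))\<^sup>2)"
    using assms(4) vanish by (auto simp: fun_eq_iff indicator_def)
  ultimately show ?thesis using um[OF assms(2)] by (simp add: L2_def set_integrable_def)
qed

lemma AE_lebesgue_on_negligible:
  assumes "E \<in> sets lebesgue" "AE t in lebesgue_on E. P t"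
  obtains N where "negligible N" "\<And>t. t \<in> E \<Longrightarrow> t \<notin> N \<Longrightarrow> P t"
proof -
  have "AE t in lebesgue. t \<in> E \<longrightarrow> P t"
    using assms by (simp add: AE_restrict_space_iff)
  then obtain N where "N \<in> null_sets lebesgue" "{t \<in> space lebesgue. \<not> (t \<in> E \<longrightarrow> P t)} \<subseteq> N"
    by (auto simp: eventually_ae_filter)
  then show thesis
    by (intro that[of N]) (auto simp: negligible_iff_null_sets)
qed

text \<open>Essential boundedness and vanishing outside \<open>E\<close> are turned into pointwise properties, so that
  no exceptional null sets have to be carried through the control construction.\<close>
lemma Linf_representative:
  assumes "v \<in> Linf E" "E \<in> sets lebesgue"
  obtains w N where "bounded_measurable w" "negligible N"
    "\<And>t. t \<in> E \<Longrightarrow> t \<notin> N \<Longrightarrow> w t = v t" "\<And>t. t \<notin> E \<Longrightarrow> w t = 0"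
proof -
  obtain M where M: "AE t in lebesgue_on E. norm (v t) \<le> M" and vm: "v measurable_on E"
    using assms(1) by (auto simp: Linf_def)
  obtain N where N: "negligible N" "\<And>t. t \<in> E \<Longrightarrow> t \<notin> N \<Longrightarrow> norm (v t) \<le> M"
    by (rule AE_lebesgue_on_negligible[OF assms(2) M]) blast
  define w where "w t = (if t \<in> E - N then v t else 0)" for t
  have "w measurable_on UNIV"
    by (rule measurable_on_spike[OF iffD2[OF measurable_on_UNIV vm] N(1)]) (auto simp: w_def)
  moreover have "norm (w t) \<le> max M 0" for t using N(2)[of t] by (auto simp: w_def)
  then have "bounded (range w)" by (auto simp: bounded_iff)
  ultimately show thesis
    using N(1) by (intro that[of w N]) (auto simp: bounded_measurable_def w_def)
qed

section \<open>Strongly continuous semigroups and their generators\<close>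

locale semigroup_generator =
  fixes D :: "'h::banach set" and A :: "'h \<Rightarrow> 'h" and S :: "real \<Rightarrow> 'h \<Rightarrow> 'h"
  assumes generates: "generates D A S"
begin

lemma S_linear: "0 \<le> t \<Longrightarrow> bounded_linear (S t)"
  and S_zero: "S 0 x = x"
  and S_add: "0 \<le> r \<Longrightarrow> 0 \<le> t \<Longrightarrow> S (r + t) x = S r (S t x)"
  and S_tendsto: "((\<lambda>t. S t x) \<longlongrightarrow> x) (at_right 0)"
  using generates by (auto simp: generates_def C0_semigroup_def)

lemmas S_diff = linear_diff[OF bounded_linear.linear[OF S_linear]]
  and S_plus = linear_add[OF bounded_linear.linear[OF S_linear]]
  and S_scale = linear_scale[OF bounded_linear.linear[OF S_linear]]

lemma domain_iff: "x \<in> D \<longleftrightarrow> (\<exists>z. ((\<lambda>t. (S t x - x) /\<^sub>R t) \<longlongrightarrow> z) (at_right 0))"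
  using generates unfolding generates_def by blast

lemma generator_tendsto: "x \<in> D \<Longrightarrow> ((\<lambda>t. (S t x - x) /\<^sub>R t) \<longlongrightarrow> A x) (at_right 0)"
  using generates by (auto simp: generates_def)

lemma generatorI:
  assumes "((\<lambda>t. (S t x - x) /\<^sub>R t) \<longlongrightarrow> z) (at_right 0)"
  shows "x \<in> D" "A x = z"
proof -
  show "x \<in> D" using assms domain_iff by blast
  then show "A x = z" using tendsto_unique[OF _ generator_tendsto assms] by simp
qed

lemma S_orbit_small:
  assumes "e > 0"
  obtains \<delta> where "\<delta> > 0" "\<And>t. 0 \<le> t \<Longrightarrow> t < \<delta> \<Longrightarrow> norm (S t x - x) < e"
proof -
  obtain \<delta> where "\<delta> > 0" "\<And>t. 0 < t \<Longrightarrow> t < \<delta> \<Longrightarrow> dist (S t x) x < e"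
    using tendstoD[OF S_tendsto \<open>e > 0\<close>] by (auto simp: eventually_at_right_field)
  then show thesis using that[of \<delta>] assms by (metis S_zero cancel_comm_monoid_add_class.diff_cancel dist_norm norm_zero order_le_less)
qed

text \<open>The principle of uniform boundedness: each orbit is bounded near \<open>0\<close> because it is right-continuous
  there, so the closed sets \<open>E n\<close> of states whose orbits stay below \<open>n\<close> on the interval of length
  \<open>1 / (n + 1)\<close> cover the space, and by Baire's theorem one of them contains a ball.\<close>
lemma S_bounded_near_0:
  obtains M \<delta> where "\<delta> > 0" "\<And>t x. 0 \<le> t \<Longrightarrow> t \<le> \<delta> \<Longrightarrow> norm (S t x) \<le> M * norm x"
proof -
  define E where "E n = {x. \<forall>t\<in>{0..1 / (real n + 1)}. norm (S t x) \<le> real n}" for n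
  have closed: "closed (E n)" for n
  proof -
    have "E n = (\<Inter>t\<in>{0..1 / (real n + 1)}. {x. norm (S t x) \<le> real n})" by (auto simp: E_def)
    moreover have "closed {x. norm (S t x) \<le> real n}" if "0 \<le> t" for t
      by (intro closed_Collect_le continuous_intros bounded_linear.continuous_on[OF S_linear[OF that]])
    ultimately show ?thesis by auto
  qed
  have "x \<in> (\<Union>n. E n)" for x
  proof -
    obtain \<delta> where \<delta>: "\<delta> > 0" "\<And>t. 0 \<le> t \<Longrightarrow> t < \<delta> \<Longrightarrow> norm (S t x - x) < 1"
      using S_orbit_small[of 1] by auto
    obtain n where n: "real n \<ge> max (norm x + 1) (1 / \<delta>)" using real_arch_simple by blast
    have "1 / (real n + 1) < \<delta>"
      using n \<open>\<delta> > 0\<close> by (simp add: field_simps)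
    then have "norm (S t x) \<le> n" if "t \<in> {0..1 / (real n + 1)}" for t
      using \<delta>(2)[of t] that n norm_triangle_ineq2[of "S t x" x] by auto
    then have "x \<in> E n" by (auto simp: E_def)
    then show ?thesis by blast
  qed
  then have union: "(\<Union>n. E n) = UNIV" by auto
  have "\<exists>n. interior (E n) \<noteq> {}"
  proof (rule ccontr)
    assume "\<not> ?thesis"
    then have "euclidean interior_of (\<Union> (range E)) = {}"
      using closed completely_metrizable_space_euclidean by (intro Baire_category_alt) auto
    then show False using union by simp
  qed
  then obtain n x0 r where r: "r > 0" "ball x0 r \<subseteq> E n"
    by (auto simp: mem_interior)
  have "norm (S t x) \<le> (4 * real n / r) * norm x" if t: "0 \<le> t" "t \<le> 1 / (real n + 1)" for t x
  proof (cases "x = 0")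
    case False
    \<comment> \<open>Rescaled so that \<open>x0 + y\<close> stays in the ball; \<open>y\<close> is the difference of two states of \<open>E n\<close>.\<close>
    define y where "y = (r / (2 * norm x)) *\<^sub>R x"
    have "norm y < r" using False r by (simp add: y_def)
    then have "x0 + y \<in> E n" "x0 \<in> E n" using r by (auto simp: dist_norm)
    then have "norm (S t (x0 + y)) \<le> n" "norm (S t x0) \<le> n" using t by (auto simp: E_def)
    then have "norm (S t y) \<le> 2 * n"
      using norm_triangle_ineq4[of "S t (x0 + y)" "S t x0"] by (simp add: S_plus[OF t(1)])
    moreover have "S t y = (r / (2 * norm x)) *\<^sub>R S t x" by (simp add: y_def S_scale[OF t(1)])
    ultimately show ?thesis using False r by (simp add: field_simps)
  qed (simp add: linear_0[OF bounded_linear.linear[OF S_linear[OF t(1)]]])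
  then show thesis using that[of "1 / (real n + 1)" "4 * real n / r"] by simp
qed

lemma S_bounded:
  obtains M where "M > 0" "\<And>t x. 0 \<le> t \<Longrightarrow> t \<le> T \<Longrightarrow> norm (S t x) \<le> M * norm x"
proof -
  obtain M0 \<delta> where \<delta>: "\<delta> > 0" and M0: "\<And>t x. 0 \<le> t \<Longrightarrow> t \<le> \<delta> \<Longrightarrow> norm (S t x) \<le> M0 * norm x"
    by (rule S_bounded_near_0) blast
  define M where "M = max M0 1"
  have M: "norm (S t x) \<le> M * norm x" if "0 \<le> t" "t \<le> \<delta>" for t x
    using M0[OF that, of x] mult_right_mono[of M0 M "norm x"] by (simp add: M_def)
  have "M \<ge> 1" by (simp add: M_def)
  have pow: "norm (S t x) \<le> M ^ k * norm x" if "0 \<le> t" "t \<le> real k * \<delta>" for k t x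
    using that
  proof (induction k arbitrary: t)
    case 0
    then show ?case by (simp add: S_zero)
  next
    case (Suc k)
    show ?case
    proof (cases "t \<le> \<delta>")
      case True
      have "M \<le> M ^ Suc k" using \<open>M \<ge> 1\<close> by (simp add: one_le_power)
      then show ?thesis using M[OF Suc.prems(1) True, of x] mult_right_mono[of M "M ^ Suc k" "norm x"] by simp
    next
      case False
      have "S t x = S \<delta> (S (t - \<delta>) x)" using S_add[of \<delta> "t - \<delta>" x] False \<delta> by simp
      also have "norm \<dots> \<le> M * norm (S (t - \<delta>) x)" using M \<delta> by simp
      also have "norm (S (t - \<delta>) x) \<le> M ^ k * norm x"
        using Suc.IH[of "t - \<delta>"] Suc.prems False by (simp add: algebra_simps)
      finally show ?thesis using \<open>M \<ge> 1\<close> by (simp add: mult.assoc)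
    qed
  qed
  obtain k where "T / \<delta> \<le> real k" using real_arch_simple by blast
  then have "T \<le> real k * \<delta>" using \<delta> by (simp add: field_simps)
  then show thesis using that[of "M ^ k"] pow[of _ k] \<open>M \<ge> 1\<close> by fastforce
qed

text \<open>Two-sided continuity of orbits comes from right-continuity at \<open>0\<close> alone, because the earlier of the
  two times can be factored out of the difference.\<close>
lemma S_increment_le:
  assumes M: "\<And>t x. 0 \<le> t \<Longrightarrow> t \<le> T \<Longrightarrow> norm (S t x) \<le> M * norm x"
    and "a \<in> {0..T}" "b \<in> {0..T}"
  shows "norm (S a x - S b x) \<le> M * norm (S \<bar>a - b\<bar> x - x)"
proof -
  have *: "norm (S b x - S a x) \<le> M * norm (S (b - a) x - x)" if "0 \<le> a" "a \<le> b" "b \<le> T" for a b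
  proof -
    have "S b x - S a x = S a (S (b - a) x - x)"
      using that S_add[of a "b - a" x] by (simp add: S_diff)
    then show ?thesis using M that by simp
  qed
  show ?thesis
    using *[of a b] *[of b a] assms by (cases "a \<le> b") (auto simp: norm_minus_commute)
qed

lemma S_jointly_continuous: "continuous_on ({0..} \<times> UNIV) (\<lambda>(t, x). S t x)"
  unfolding continuous_on_iff
proof (intro ballI allI impI)
  fix p :: "real \<times> 'h" and e :: real assume "p \<in> {0..} \<times> UNIV" "e > 0"
  then obtain b y where p: "p = (b, y)" "b \<ge> 0" by auto
  obtain M where "M > 0" and M: "\<And>t x. 0 \<le> t \<Longrightarrow> t \<le> b + 1 \<Longrightarrow> norm (S t x) \<le> M * norm x"
    by (rule S_bounded[of "b + 1"]) blast
  have e': "e / (2 * M) > 0" using \<open>e > 0\<close> \<open>M > 0\<close> by simp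
  then obtain \<delta> where "\<delta> > 0" and \<delta>: "\<And>t. 0 \<le> t \<Longrightarrow> t < \<delta> \<Longrightarrow> norm (S t y - y) < e / (2 * M)"
    by (rule S_orbit_small[of _ y]) blast
  show "\<exists>d>0. \<forall>q\<in>{0..} \<times> UNIV. dist q p < d \<longrightarrow>
      dist (case q of (t, x) \<Rightarrow> S t x) (case p of (t, x) \<Rightarrow> S t x) < e"
  proof (intro exI[of _ "min 1 (min \<delta> (e / (2 * M)))"] conjI ballI impI)
    fix q :: "real \<times> 'h" assume "q \<in> {0..} \<times> UNIV" and d: "dist q p < min 1 (min \<delta> (e / (2 * M)))"
    then obtain a x where q: "q = (a, x)" "a \<ge> 0" by auto
    have da: "\<bar>a - b\<bar> < min 1 \<delta>" and dx: "norm (x - y) < e / (2 * M)"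
      using d dist_fst_le[of q p] dist_snd_le[of q p] by (auto simp: p q dist_norm)
    have "norm (S a (x - y)) \<le> M * norm (x - y)" using M q da by auto
    also have "\<dots> < e / 2" using dx \<open>M > 0\<close> by (simp add: field_simps)
    finally have 1: "norm (S a x - S a y) < e / 2" using S_diff[OF q(2)] by simp
    have "norm (S a y - S b y) \<le> M * norm (S \<bar>a - b\<bar> y - y)"
      using S_increment_le[OF M] p q da by auto
    also have "\<dots> < e / 2" using \<delta>[of "\<bar>a - b\<bar>"] da \<open>M > 0\<close> by (simp add: field_simps)
    finally show "dist (case q of (t, x) \<Rightarrow> S t x) (case p of (t, x) \<Rightarrow> S t x) < e"
      using 1 norm_triangle_ineq[of "S a x - S a y" "S a y - S b y"] by (simp add: p q dist_norm)
  qed (use \<open>\<delta> > 0\<close> e' in auto)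
qed

lemma continuous_on_S:
  assumes "continuous_on T f" "continuous_on T g" "\<And>t. t \<in> T \<Longrightarrow> f t \<ge> 0"
  shows "continuous_on T (\<lambda>t. S (f t) (g t))"
  using continuous_on_compose2[OF S_jointly_continuous continuous_on_Pair[OF assms(1,2)]] assms(3)
  by force

lemma S_domain:
  assumes "x \<in> D" "0 \<le> t"
  shows "S t x \<in> D" "A (S t x) = S t (A x)"
proof -
  have "((\<lambda>h. S t ((S h x - x) /\<^sub>R h)) \<longlongrightarrow> S t (A x)) (at_right 0)"
    using bounded_linear.tendsto[OF S_linear[OF assms(2)] generator_tendsto[OF assms(1)]] .
  moreover have "\<forall>\<^sub>F h in at_right 0. S t ((S h x - x) /\<^sub>R h) = (S h (S t x) - S t x) /\<^sub>R h"
  proof (rule eventually_at_rightI[of 0 1])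
    fix h :: real assume "h \<in> {0<..<1}"
    then show "S t ((S h x - x) /\<^sub>R h) = (S h (S t x) - S t x) /\<^sub>R h"
      using S_add[of h t x] S_add[of t h x] assms by (simp add: S_diff S_scale add.commute)
  qed simp
  ultimately have *: "((\<lambda>h. (S h (S t x) - S t x) /\<^sub>R h) \<longlongrightarrow> S t (A x)) (at_right 0)"
    by (simp add: tendsto_cong)
  show "S t x \<in> D" "A (S t x) = S t (A x)" using generatorI[OF *] by auto
qed

lemma generator_linear_combination:
  assumes "x \<in> D" "y \<in> D"
  shows "a *\<^sub>R x + b *\<^sub>R y \<in> D" "A (a *\<^sub>R x + b *\<^sub>R y) = a *\<^sub>R A x + b *\<^sub>R A y"
proof -
  have "((\<lambda>h. a *\<^sub>R ((S h x - x) /\<^sub>R h) + b *\<^sub>R ((S h y - y) /\<^sub>R h)) \<longlongrightarrow> a *\<^sub>R A x + b *\<^sub>R A y) (at_right 0)"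
    by (intro tendsto_intros generator_tendsto assms)
  moreover have "\<forall>\<^sub>F h in at_right 0. a *\<^sub>R ((S h x - x) /\<^sub>R h) + b *\<^sub>R ((S h y - y) /\<^sub>R h)
      = (S h (a *\<^sub>R x + b *\<^sub>R y) - (a *\<^sub>R x + b *\<^sub>R y)) /\<^sub>R h"
  proof (rule eventually_at_rightI[of 0 1])
    fix h :: real assume "h \<in> {0<..<1}"
    then have "0 \<le> h" by simp
    then show "a *\<^sub>R ((S h x - x) /\<^sub>R h) + b *\<^sub>R ((S h y - y) /\<^sub>R h)
      = (S h (a *\<^sub>R x + b *\<^sub>R y) - (a *\<^sub>R x + b *\<^sub>R y)) /\<^sub>R h"
      by (simp add: S_plus S_scale algebra_simps)
  qed simp
  ultimately have *: "((\<lambda>h. (S h (a *\<^sub>R x + b *\<^sub>R y) - (a *\<^sub>R x + b *\<^sub>R y)) /\<^sub>R h)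
      \<longlongrightarrow> a *\<^sub>R A x + b *\<^sub>R A y) (at_right 0)"
    by (simp add: tendsto_cong)
  show "a *\<^sub>R x + b *\<^sub>R y \<in> D" "A (a *\<^sub>R x + b *\<^sub>R y) = a *\<^sub>R A x + b *\<^sub>R A y"
    using generatorI[OF *] by auto
qed

lemma subspace_domain: "subspace D"
proof -
  have "((\<lambda>h. (S h 0 - 0) /\<^sub>R h) \<longlongrightarrow> 0) (at_right 0)"
    by (rule Lim_transform_eventually[OF tendsto_const eventually_at_rightI[of 0 1]])
       (simp_all add: linear_0[OF bounded_linear.linear[OF S_linear]])
  then have "0 \<in> D" by (rule generatorI)
  then show ?thesis
    using generator_linear_combination(1)[of _ _ 1 1] generator_linear_combination(1)[of _ 0 _ 1]
    by (auto simp: subspace_def)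
qed

text \<open>The generator only gives the right derivative at \<open>0\<close>. Factoring out the operator at the earlier
  time transports it to any time, uniformly because of the local bound; for increments to the left the
  derivative is first obtained at the moving point \<open>y\<close>, and continuity of the orbit of \<open>A X\<close> corrects
  this to \<open>t\<close>.\<close>
lemma orbit_has_vector_derivative:
  assumes X: "X \<in> D" and t: "t \<in> {0..T}"
  shows "((\<lambda>r. S r X) has_vector_derivative S t (A X)) (at t within {0..T})"
  unfolding has_vector_derivative_def has_derivative_within_alt
proof (intro conjI allI impI bounded_linear_scaleR_left)
  fix e :: real assume "e > 0"
  obtain M where "M > 0" and M: "\<And>t x. 0 \<le> t \<Longrightarrow> t \<le> T \<Longrightarrow> norm (S t x) \<le> M * norm x"
    by (rule S_bounded[of T]) blast
  have e': "e / (2 * M) > 0" using \<open>e > 0\<close> \<open>M > 0\<close> by simp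
  obtain \<delta>1 where "\<delta>1 > 0" and \<delta>1: "\<And>h. 0 < h \<Longrightarrow> h < \<delta>1 \<Longrightarrow> dist ((S h X - X) /\<^sub>R h) (A X) < e / (2 * M)"
    using tendstoD[OF generator_tendsto[OF X] e'] by (auto simp: eventually_at_right_field)
  obtain \<delta>2 where "\<delta>2 > 0" and \<delta>2: "\<And>h. 0 \<le> h \<Longrightarrow> h < \<delta>2 \<Longrightarrow> norm (S h (A X) - A X) < e / (2 * M)"
    using e' by (rule S_orbit_small[of _ "A X"]) blast
  have step: "norm (S b X - S a X - (b - a) *\<^sub>R S a (A X)) \<le> (e / 2) * (b - a)"
    if "0 \<le> a" "a < b" "b \<le> T" "b - a < \<delta>1" for a b
  proof -
    define h where "h = b - a"
    have h: "h > 0" "h < \<delta>1" "b = a + h" using that by (auto simp: h_def)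
    have "S b X - S a X - h *\<^sub>R S a (A X) = S a (S h X - X - h *\<^sub>R A X)"
      using that h by (simp add: S_add S_diff S_scale)
    also have "norm \<dots> \<le> M * norm (S h X - X - h *\<^sub>R A X)" using M that by simp
    also have "S h X - X - h *\<^sub>R A X = h *\<^sub>R ((S h X - X) /\<^sub>R h - A X)"
      using h by (simp add: scaleR_diff_right)
    also have "norm \<dots> = h * dist ((S h X - X) /\<^sub>R h) (A X)" using h by (simp add: dist_norm)
    also have "M * \<dots> \<le> M * (h * (e / (2 * M)))"
      using \<delta>1[OF h(1,2)] h \<open>M > 0\<close> by (intro mult_left_mono) auto
    also have "\<dots> = (e / 2) * h" using \<open>M > 0\<close> by simp
    finally show ?thesis by (simp add: h_def)
  qed
  show "\<exists>d>0. \<forall>y\<in>{0..T}. norm (y - t) < d \<longrightarrow>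
      norm (S y X - S t X - (y - t) *\<^sub>R S t (A X)) \<le> e * norm (y - t)"
  proof (intro exI[of _ "min \<delta>1 \<delta>2"] conjI ballI impI)
    fix y assume y: "y \<in> {0..T}" "norm (y - t) < min \<delta>1 \<delta>2"
    consider "y = t" | "t < y" | "y < t" by linarith
    then show "norm (S y X - S t X - (y - t) *\<^sub>R S t (A X)) \<le> e * norm (y - t)"
    proof cases
      case 2
      have "norm (S y X - S t X - (y - t) *\<^sub>R S t (A X)) \<le> (e / 2) * (y - t)"
        using step[of t y] y t 2 by simp
      also have "\<dots> \<le> e * norm (y - t)"
        using 2 \<open>e > 0\<close> by (simp add: mult_right_mono)
      finally show ?thesis .
    next
      case 3
      define h where "h = t - y"
      have h: "h > 0" "h < \<delta>1" "h < \<delta>2" using 3 y by (auto simp: h_def)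
      have "norm (S y (A X) - S t (A X)) \<le> M * norm (S h (A X) - A X)"
        using S_increment_le[OF M y(1) t, of "A X"] 3 by (simp add: h_def)
      also have "\<dots> \<le> M * (e / (2 * M))" using \<delta>2[of h] h \<open>M > 0\<close> by (intro mult_left_mono) auto
      also have "\<dots> = e / 2" using \<open>M > 0\<close> by simp
      finally have "norm (h *\<^sub>R (S y (A X) - S t (A X))) \<le> h * (e / 2)" using h by simp
      moreover have "norm (S t X - S y X - h *\<^sub>R S y (A X)) \<le> (e / 2) * h"
        using step[of y t] y t 3 h by (simp add: h_def)
      moreover have "S y X - S t X - (y - t) *\<^sub>R S t (A X)
        = - ((S t X - S y X - h *\<^sub>R S y (A X)) + h *\<^sub>R (S y (A X) - S t (A X)))"
        by (simp add: h_def algebra_simps)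
      then have "norm (S y X - S t X - (y - t) *\<^sub>R S t (A X))
        \<le> norm (S t X - S y X - h *\<^sub>R S y (A X)) + norm (h *\<^sub>R (S y (A X) - S t (A X)))"
        by (metis norm_minus_cancel norm_triangle_ineq)
      ultimately have "norm (S y X - S t X - (y - t) *\<^sub>R S t (A X)) \<le> (e / 2) * h + h * (e / 2)"
        by linarith
      also have "\<dots> = e * norm (y - t)" using 3 by (simp add: h_def)
      finally show ?thesis .
    qed simp
  qed (use \<open>\<delta>1 > 0\<close> \<open>\<delta>2 > 0\<close> in auto)
qed

lemma integral_by_parts_orbit:
  assumes X: "X \<in> D" and "0 \<le> T"
    and deriv: "\<And>r. r \<in> {0..T} \<Longrightarrow> (\<phi> has_real_derivative \<phi>' r) (at r within {0..T})"
    and cont: "continuous_on {0..T} \<phi>'"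
  shows "((\<lambda>r. \<phi> r *\<^sub>R S r (A X)) has_integral
    \<phi> T *\<^sub>R S T X - \<phi> 0 *\<^sub>R X - integral {0..T} (\<lambda>r. \<phi>' r *\<^sub>R S r X)) {0..T}"
proof -
  have "((\<lambda>r. \<phi> r *\<^sub>R S r (A X) + \<phi>' r *\<^sub>R S r X) has_integral \<phi> T *\<^sub>R S T X - \<phi> 0 *\<^sub>R S 0 X) {0..T}"
  proof (rule fundamental_theorem_of_calculus[OF \<open>0 \<le> T\<close>])
    show "((\<lambda>r. \<phi> r *\<^sub>R S r X) has_vector_derivative \<phi> r *\<^sub>R S r (A X) + \<phi>' r *\<^sub>R S r X) (at r within {0..T})"
      if "r \<in> {0..T}" for r
      using has_vector_derivative_scaleR[OF deriv orbit_has_vector_derivative[OF X]] that by blast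
  qed
  moreover have "(\<lambda>r. \<phi>' r *\<^sub>R S r X) integrable_on {0..T}"
    by (intro integrable_continuous_real continuous_on_scaleR cont continuous_on_S continuous_intros) auto
  ultimately have "((\<lambda>r. (\<phi> r *\<^sub>R S r (A X) + \<phi>' r *\<^sub>R S r X) - \<phi>' r *\<^sub>R S r X) has_integral
      (\<phi> T *\<^sub>R S T X - \<phi> 0 *\<^sub>R S 0 X) - integral {0..T} (\<lambda>r. \<phi>' r *\<^sub>R S r X)) {0..T}"
    by (intro has_integral_diff integrable_integral)
  then show ?thesis by (simp add: S_zero)
qed

text \<open>The solution formula for a constant inhomogeneity: it expresses that steady states are held in
  place by their constant controls.\<close>
lemma orbit_has_integral:
  assumes "X \<in> D" "0 \<le> t"
  shows "((\<lambda>r. S (t - r) (A X)) has_integral S t X - X) {0..t}"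
  using has_integral_reverse[OF integral_by_parts_orbit[OF assms, of "\<lambda>_. 1" "\<lambda>_. 0"]] by simp

end

section \<open>The resolvent and the smoothing effect of averaging orbits\<close>

locale resolvent_semigroup = semigroup_generator D A S
  for D :: "'h::banach set" and A :: "'h \<Rightarrow> 'h" and S :: "real \<Rightarrow> 'h \<Rightarrow> 'h" +
  fixes \<beta> :: real
  assumes in_resolvent_set: "in_resolvent_set D A \<beta>"
begin

abbreviation R :: "'h \<Rightarrow> 'h" where "R \<equiv> resolvent D A \<beta>"

lemma R_bounded_linear: "bounded_linear R"
  using in_resolvent_set by (simp add: in_resolvent_set_def)

interpretation R: bounded_linear R by (rule R_bounded_linear)

lemma bij: "bij_betw (\<lambda>x. \<beta> *\<^sub>R x - A x) D UNIV"
  using in_resolvent_set by (simp add: in_resolvent_set_def)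

lemma R_domain: "R y \<in> D"
  using bij unfolding resolvent_def bij_betw_def by (auto intro!: inv_into_into)

lemma R_right: "\<beta> *\<^sub>R R y - A (R y) = y"
  using bij unfolding resolvent_def bij_betw_def by (auto intro!: f_inv_into_f[of y "\<lambda>x. \<beta> *\<^sub>R x - A x"])

lemma A_R: "A (R y) = \<beta> *\<^sub>R R y - y"
  using R_right[of y] by (simp add: algebra_simps)

lemma R_left: "x \<in> D \<Longrightarrow> R (\<beta> *\<^sub>R x - A x) = x"
  using bij unfolding resolvent_def bij_betw_def by (auto intro!: inv_into_f_f)

lemma R_eq_iff: "R x = R y \<longleftrightarrow> x = y"
  by (metis R_right)

lemma R_S: "0 \<le> t \<Longrightarrow> R (S t y) = S t (R y)"
  using R_left[OF S_domain(1)[OF R_domain], of t y] R_right[of y] S_domain(2)[OF R_domain, of t y]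
  by (metis S_diff S_scale)

lemma weighted_orbit_integrable:
  assumes "continuous_on {0..T} \<psi>"
  shows "(\<lambda>r. \<psi> r *\<^sub>R S r z) integrable_on {0..T}"
  by (intro integrable_continuous_real continuous_on_scaleR assms continuous_on_S continuous_intros) auto

lemma R_weighted_orbit_integral:
  assumes "continuous_on {0..T} \<psi>"
  shows "integral {0..T} (\<lambda>r. \<psi> r *\<^sub>R S r (R x)) = R (integral {0..T} (\<lambda>r. \<psi> r *\<^sub>R S r x))"
proof -
  have "integral {0..T} (\<lambda>r. \<psi> r *\<^sub>R S r (R x)) = integral {0..T} (\<lambda>r. R (\<psi> r *\<^sub>R S r x))"
    by (rule integral_cong) (simp add: R.scaleR R_S)
  also have "\<dots> = R (integral {0..T} (\<lambda>r. \<psi> r *\<^sub>R S r x))"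
    using integral_linear[OF weighted_orbit_integrable[OF assms] R_bounded_linear] by (simp add: o_def)
  finally show ?thesis .
qed

text \<open>The resolvent avoids difference quotients. Writing \<open>x = \<beta> R x - A (R x)\<close> and integrating the
  second term by parts, which is allowed as \<open>R x\<close> is in the domain, presents the integral as \<open>R\<close> of an
  explicit vector: it lies in the range of \<open>R\<close>, and \<open>A\<close> can be evaluated on it.\<close>
lemma weighted_orbit_integral_in_domain:
  assumes "0 \<le> T"
    and deriv: "\<And>r. r \<in> {0..T} \<Longrightarrow> (\<phi> has_real_derivative \<phi>' r) (at r within {0..T})"
    and cont: "continuous_on {0..T} \<phi>'"
  shows "integral {0..T} (\<lambda>r. \<phi> r *\<^sub>R S r x) \<in> D"
    and "A (integral {0..T} (\<lambda>r. \<phi> r *\<^sub>R S r x))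
      = \<phi> T *\<^sub>R S T x - \<phi> 0 *\<^sub>R x - integral {0..T} (\<lambda>r. \<phi>' r *\<^sub>R S r x)"
proof -
  have cont\<phi>: "continuous_on {0..T} \<phi>"
    using deriv by (intro DERIV_continuous_on) blast
  let ?y = "integral {0..T} (\<lambda>r. \<phi> r *\<^sub>R S r x)"
  let ?w = "\<phi> T *\<^sub>R S T x - \<phi> 0 *\<^sub>R x - integral {0..T} (\<lambda>r. \<phi>' r *\<^sub>R S r x)"
  have AR: "integral {0..T} (\<lambda>r. \<phi> r *\<^sub>R S r (A (R x))) = R ?w"
    using integral_unique[OF integral_by_parts_orbit[OF R_domain assms]] assms(1)
    by (simp add: R.diff R.scaleR R_S R_weighted_orbit_integral[OF cont])
  have "?y = integral {0..T} (\<lambda>r. \<beta> *\<^sub>R (\<phi> r *\<^sub>R S r (R x)) - \<phi> r *\<^sub>R S r (A (R x)))"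
  proof (rule integral_cong)
    fix r assume "r \<in> {0..T}"
    then have "S r x = \<beta> *\<^sub>R S r (R x) - S r (A (R x))"
      using R_right[of x] by (metis S_diff S_scale atLeastAtMost_iff)
    then show "\<phi> r *\<^sub>R S r x = \<beta> *\<^sub>R (\<phi> r *\<^sub>R S r (R x)) - \<phi> r *\<^sub>R S r (A (R x))"
      by (simp add: scaleR_diff_right mult.commute)
  qed
  also have "\<dots> = \<beta> *\<^sub>R integral {0..T} (\<lambda>r. \<phi> r *\<^sub>R S r (R x)) - integral {0..T} (\<lambda>r. \<phi> r *\<^sub>R S r (A (R x)))"
    using integral_diff[OF integrable_cmul[OF weighted_orbit_integrable[OF cont\<phi>], of \<beta>] weighted_orbit_integrable[OF cont\<phi>]]
    by (simp only: integral_cmul)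
  also have "\<dots> = R (\<beta> *\<^sub>R ?y - ?w)"
    by (simp add: R_weighted_orbit_integral[OF cont\<phi>] AR R.diff R.scaleR)
  finally have y: "?y = R (\<beta> *\<^sub>R ?y - ?w)" .
  show "?y \<in> D" by (subst y) (rule R_domain)
  show "A ?y = ?w" using A_R[of "\<beta> *\<^sub>R ?y - ?w"] y[symmetric] by simp
qed

text \<open>Averages of an orbit over short intervals lie in the domain and converge to its starting point.\<close>
lemma domain_dense: "closure D = UNIV"
proof -
  have "x \<in> closure D" for x
  proof (rule closure_approachable[THEN iffD2], intro allI impI)
    fix e :: real assume "e > 0"
    then obtain \<delta> where \<delta>: "\<delta> > 0" "\<And>t. 0 \<le> t \<Longrightarrow> t < \<delta> \<Longrightarrow> norm (S t x - x) < e / 2"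
      using S_orbit_small[of "e / 2" x] by auto
    define T where "T = \<delta> / 2"
    have "T > 0" using \<delta> by (simp add: T_def)
    define y where "y = integral {0..T} (\<lambda>r. (1 / T) *\<^sub>R S r x)"
    have "y \<in> D"
      unfolding y_def using weighted_orbit_integral_in_domain(1)[of T "\<lambda>_. 1 / T" "\<lambda>_. 0"] \<open>T > 0\<close> by simp
    have int: "(\<lambda>r. (1 / T) *\<^sub>R S r x) integrable_on {0..T}"
      by (intro integrable_continuous_real continuous_on_S continuous_intros) auto
    have "y - x = integral {0..T} (\<lambda>r. (1 / T) *\<^sub>R S r x) - integral {0..T} (\<lambda>r. (1 / T) *\<^sub>R x)"
      using \<open>T > 0\<close> by (simp add: y_def)
    also have "\<dots> = integral {0..T} (\<lambda>r. (1 / T) *\<^sub>R (S r x - x))"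
      using integral_diff[OF int integrable_continuous_real[OF continuous_on_const]]
      by (simp add: scaleR_diff_right)
    also have "norm \<dots> \<le> (e / 2 / T) * (T - 0)"
    proof (rule integral_bound)
      show "continuous_on {0..T} (\<lambda>r. (1 / T) *\<^sub>R (S r x - x))"
        by (intro continuous_on_S continuous_intros) auto
      show "norm ((1 / T) *\<^sub>R (S r x - x)) \<le> e / 2 / T" if "r \<in> {0..T}" for r
        using \<delta>(2)[of r] that \<open>T > 0\<close> by (simp add: T_def divide_right_mono)
    qed (use \<open>T > 0\<close> in simp)
    also have "\<dots> < e" using \<open>T > 0\<close> \<open>e > 0\<close> by simp
    finally show "\<exists>y\<in>D. dist y x < e" using \<open>y \<in> D\<close> by (auto simp: dist_norm)
  qed
  then show ?thesis by auto
qed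

text \<open>Each application of \<open>A\<close> to the average moves a derivative onto the weight, as long as
  the boundary terms vanish; a weight divisible by \<open>(r (1 - r))\<^sup>k\<close> permits \<open>k\<close> applications.\<close>
lemma polynomial_smoothing:
  fixes p :: "real poly"
  assumes "([:0, 1:] * [:1, -1:]) ^ k dvd p"
  shows "integral {0..1} (\<lambda>r. poly p r *\<^sub>R S r x) \<in> domain_power D A k"
  using assms
proof (induction k arbitrary: p)
  case 0
  then show ?case by (simp add: domain_power_def)
next
  case (Suc k)
  define m :: "real poly" where "m = [:0, 1:] * [:1, -1:]"
  obtain q where p: "p = m ^ Suc k * q" using Suc.prems unfolding m_def by (rule dvdE)
  have ends: "poly p 0 = 0" "poly p 1 = 0" by (simp_all add: p m_def)
  have "pderiv p = m ^ k * (m * pderiv q + smult (of_nat (Suc k)) (pderiv m) * q)"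
    unfolding p pderiv_mult pderiv_power_Suc by (simp add: algebra_simps)
  then have "m ^ k dvd pderiv p" by simp
  then have IH: "integral {0..1} (\<lambda>r. poly (- pderiv p) r *\<^sub>R S r x) \<in> domain_power D A k"
    by (intro Suc.IH) (simp add: m_def[symmetric] del: mult_pCons_left mult_pCons_right)
  have deriv: "(poly p has_real_derivative poly (pderiv p) r) (at r within {0..1})" for r
    using poly_DERIV has_field_derivative_at_within by blast
  note dom = weighted_orbit_integral_in_domain[of 1, OF _ deriv, of x]
  have *: "integral {0..1} (\<lambda>r. poly p r *\<^sub>R S r x) \<in> D"
    "A (integral {0..1} (\<lambda>r. poly p r *\<^sub>R S r x)) = integral {0..1} (\<lambda>r. poly (- pderiv p) r *\<^sub>R S r x)"
    using dom by (simp_all add: ends continuous_on_poly)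
  have "(A ^^ j) (integral {0..1} (\<lambda>r. poly p r *\<^sub>R S r x)) \<in> D" if "j < Suc k" for j
  proof (cases j)
    case (Suc i)
    then show ?thesis using that IH by (simp add: funpow_swap1 *(2) domain_power_def)
  qed (simp add: *)
  then show ?case by (simp add: domain_power_def)
qed

end

section \<open>The extrapolation space seen from the state space\<close>

lemma bounded_linear_eq_on_dense:
  assumes "bounded_linear f" "bounded_linear g" "\<And>x. x \<in> E \<Longrightarrow> f x = g x" "closure E = UNIV"
  shows "f = g"
proof -
  have "closed {x. f x = g x}"
    by (intro closed_Collect_eq bounded_linear.continuous_on[OF assms(1)]
        bounded_linear.continuous_on[OF assms(2)] continuous_on_id)
  moreover have "E \<subseteq> {x. f x = g x}" using assms(3) by auto
  ultimately have "closure E \<subseteq> {x. f x = g x}" by (rule closure_minimal[rotated])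
  then show ?thesis using assms(4) by auto
qed

lemma bounded_extension_eqI:
  assumes "bounded_linear g" "\<And>x. x \<in> E \<Longrightarrow> g (e x) = f x" "closure (e ` E) = UNIV"
  shows "bounded_extension e E f = g"
  unfolding bounded_extension_def
proof (rule the_equality)
  show "bounded_linear g \<and> (\<forall>x\<in>E. g (e x) = f x)" using assms by blast
  show "g' = g" if "bounded_linear g' \<and> (\<forall>x\<in>E. g' (e x) = f x)" for g'
    using that assms by (intro bounded_linear_eq_on_dense[of g' g "e ` E"]) auto
qed

text \<open>An isometric map is uniformly continuous and hence extends to the closure; linearity and the
  norm identity pass to limits of sequences in the dense subspace.\<close>
lemma isometric_extension_dense:
  fixes f :: "'a::real_normed_vector \<Rightarrow> 'b::banach"
  assumes E: "subspace E" "closure E = UNIV"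
    and lin: "\<And>a b x y. x \<in> E \<Longrightarrow> y \<in> E \<Longrightarrow> f (a *\<^sub>R x + b *\<^sub>R y) = a *\<^sub>R f x + b *\<^sub>R f y"
    and isom: "\<And>x. x \<in> E \<Longrightarrow> norm (f x) = norm x"
  obtains g where "bounded_linear g" "\<And>x. norm (g x) = norm x" "\<And>x. x \<in> E \<Longrightarrow> g x = f x"
proof -
  have "dist (f x) (f y) = dist x y" if "x \<in> E" "y \<in> E" for x y
    using lin[OF that, of 1 "-1"] isom[OF subspace_diff[OF E(1) that]] by (simp add: dist_norm)
  then have "uniformly_continuous_on E f"
    unfolding uniformly_continuous_on_def by auto
  then obtain g where g: "uniformly_continuous_on (closure E) g" and gf: "\<And>x. x \<in> E \<Longrightarrow> f x = g x"
    by (rule uniformly_continuous_on_extension_on_closure) blast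
  have cont: "continuous_on UNIV g" using uniformly_continuous_imp_continuous[OF g] E(2) by simp
  have approx: "\<exists>X. (\<forall>n. X n \<in> E) \<and> X \<longlonglongrightarrow> x" for x
    using closure_sequential[of x E] E(2) by auto
  have g_lim: "(\<lambda>n. g (X n)) \<longlonglongrightarrow> g x" if "X \<longlonglongrightarrow> x" for X x
    using continuous_on_tendsto_compose[OF cont that] by simp
  have lin_g: "g (a *\<^sub>R x + b *\<^sub>R y) = a *\<^sub>R g x + b *\<^sub>R g y" for a b x y
  proof -
    obtain X Y where X: "\<And>n. X n \<in> E" "X \<longlonglongrightarrow> x" and Y: "\<And>n. Y n \<in> E" "Y \<longlonglongrightarrow> y"
      using approx by metis
    have "(\<lambda>n. g (a *\<^sub>R X n + b *\<^sub>R Y n)) \<longlonglongrightarrow> g (a *\<^sub>R x + b *\<^sub>R y)"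
      by (intro g_lim tendsto_intros X Y)
    moreover have "g (a *\<^sub>R X n + b *\<^sub>R Y n) = a *\<^sub>R g (X n) + b *\<^sub>R g (Y n)" for n
      using lin[OF X(1) Y(1), of a n b n] gf X(1) Y(1) E(1) by (metis subspace_add subspace_scale)
    moreover have "(\<lambda>n. a *\<^sub>R g (X n) + b *\<^sub>R g (Y n)) \<longlonglongrightarrow> a *\<^sub>R g x + b *\<^sub>R g y"
      by (intro g_lim tendsto_intros X Y)
    ultimately show ?thesis using LIMSEQ_unique by auto
  qed
  have norm_g: "norm (g x) = norm x" for x
  proof -
    obtain X where X: "\<And>n. X n \<in> E" "X \<longlonglongrightarrow> x" using approx by metis
    have "(\<lambda>n. norm (g (X n))) \<longlonglongrightarrow> norm (g x)" by (intro tendsto_norm g_lim X)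
    moreover have "norm (g (X n)) = norm (X n)" for n using isom[OF X(1)] gf[OF X(1)] by simp
    ultimately show ?thesis using LIMSEQ_unique[OF _ tendsto_norm[OF X(2)]] by simp
  qed
  have "bounded_linear g"
    using lin_g[of 1 _ 1] lin_g[of _ _ 0 0] norm_g by (intro bounded_linear_intro[of g 1]) auto
  then show thesis using that norm_g gf by simp
qed

locale extrapolated_system = resolvent_semigroup D A S \<beta>
  for D :: "'h::banach set" and A :: "'h \<Rightarrow> 'h" and S :: "real \<Rightarrow> 'h \<Rightarrow> 'h" and \<beta> :: real +
  fixes \<iota> :: "'h \<Rightarrow> 'm::banach" and B :: "'u::real_normed_vector \<Rightarrow> 'm"
  assumes extrapolation: "extrapolation_space D A \<beta> \<iota>"
    and B_bounded_linear: "bounded_linear B"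
begin

interpretation R: bounded_linear R by (rule R_bounded_linear)

lemma \<iota>_linear: "linear \<iota>" and norm_\<iota>: "norm (\<iota> x) = norm (R x)" and \<iota>_dense: "closure (range \<iota>) = UNIV"
  using extrapolation by (auto simp: extrapolation_space_def)

lemma \<iota>_eq_iff: "\<iota> x = \<iota> y \<longleftrightarrow> x = y"
proof -
  have "\<iota> x = \<iota> y \<longleftrightarrow> norm (\<iota> (x - y)) = 0" by (simp add: linear_diff[OF \<iota>_linear])
  also have "\<dots> \<longleftrightarrow> R x = R y" by (simp add: norm_\<iota> R.diff)
  finally show ?thesis by (simp add: R_eq_iff)
qed

text \<open>On the domain, \<open>K\<close> is \<open>\<iota> (\<beta> - A)\<close>, an isometry for the norm of \<open>H\<close> by the choice of the norm on
  the extrapolation space. It is the extension of \<open>\<beta> - A\<close> to all of \<open>H\<close>.\<close>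
definition K :: "'h \<Rightarrow> 'm" where
  "K = bounded_extension (\<lambda>x. x) D (\<lambda>x. \<iota> (\<beta> *\<^sub>R x - A x))"

lemma K_bounded_linear: "bounded_linear K" and norm_K: "norm (K x) = norm x" and K_R: "K (R y) = \<iota> y"
proof -
  have "\<exists>g. bounded_linear g \<and> (\<forall>x. norm (g x) = norm x) \<and> (\<forall>x\<in>D. g x = \<iota> (\<beta> *\<^sub>R x - A x))"
  proof (rule isometric_extension_dense[OF subspace_domain domain_dense, of "\<lambda>x. \<iota> (\<beta> *\<^sub>R x - A x)"])
    fix a b x y assume xy: "x \<in> D" "y \<in> D"
    have "\<beta> *\<^sub>R (a *\<^sub>R x + b *\<^sub>R y) - A (a *\<^sub>R x + b *\<^sub>R y) = a *\<^sub>R (\<beta> *\<^sub>R x - A x) + b *\<^sub>R (\<beta> *\<^sub>R y - A y)"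
      by (simp add: generator_linear_combination(2)[OF xy] algebra_simps)
    then show "\<iota> (\<beta> *\<^sub>R (a *\<^sub>R x + b *\<^sub>R y) - A (a *\<^sub>R x + b *\<^sub>R y))
        = a *\<^sub>R \<iota> (\<beta> *\<^sub>R x - A x) + b *\<^sub>R \<iota> (\<beta> *\<^sub>R y - A y)"
      by (simp add: linear_add[OF \<iota>_linear] linear_scale[OF \<iota>_linear])
  qed (auto simp: norm_\<iota> R_left)
  then obtain g where g: "bounded_linear g" "\<And>x. norm (g x) = norm x"
    "\<And>x. x \<in> D \<Longrightarrow> g x = \<iota> (\<beta> *\<^sub>R x - A x)" by blast
  have "K = g" unfolding K_def using g domain_dense by (intro bounded_extension_eqI) auto
  then show "bounded_linear K" "norm (K x) = norm x" "K (R y) = \<iota> y"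
    using g R_domain R_right by auto
qed

interpretation K: bounded_linear K by (rule K_bounded_linear)

text \<open>The range of an isometry on a complete space is closed, and here it contains the dense range of \<open>\<iota>\<close>.\<close>
lemma bij_K: "bij K"
proof (rule bijI)
  show "inj K"
  proof (rule injI)
    fix x y assume "K x = K y"
    then show "x = y" using norm_K[of "x - y"] by (simp add: K.diff)
  qed
  have "complete (range K)"
    using complete_isometric_image[of 1 UNIV K] K_bounded_linear norm_K complete_UNIV by simp
  then have "closed (range K)" by (rule complete_imp_closed)
  moreover have "range \<iota> \<subseteq> range K" using K_R by (metis image_subsetI rangeI)
  ultimately show "surj K" using \<iota>_dense closure_minimal by (metis top.extremum_uniqueI)
qed

lemma K_inv [simp]: "K (inv K z) = z" and inv_K [simp]: "inv K (K x) = x"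
  using bij_K by (auto simp: bij_def surj_f_inv_f)

lemma inv_K_bounded_linear: "bounded_linear (inv K)"
proof (rule bounded_linear_intro[of _ 1])
  show "inv K (x + y) = inv K x + inv K y" for x y by (metis K.add K_inv inv_K)
  show "inv K (c *\<^sub>R x) = c *\<^sub>R inv K x" for c x by (metis K.scaleR K_inv inv_K)
  show "norm (inv K x) \<le> norm x * 1" for x using norm_K[of "inv K x"] by simp
qed

lemma semigroup_ext_eq:
  assumes "0 \<le> t"
  shows "semigroup_ext S \<iota> t z = K (S t (inv K z))"
proof -
  have "semigroup_ext S \<iota> t = (\<lambda>z. K (S t (inv K z)))"
    unfolding semigroup_ext_def
  proof (rule bounded_extension_eqI)
    show "bounded_linear (\<lambda>z. K (S t (inv K z)))"
      using bounded_linear_compose[OF K_bounded_linear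
          bounded_linear_compose[OF S_linear[OF assms] inv_K_bounded_linear]] .
    show "K (S t (inv K (\<iota> x))) = \<iota> (S t x)" for x
      by (simp flip: K_R add: R_S assms)
  qed (simp add: \<iota>_dense)
  then show ?thesis by simp
qed

lemma generator_ext_eq: "generator_ext D A \<iota> x = K (\<beta> *\<^sub>R R x - x)"
proof -
  have "generator_ext D A \<iota> = (\<lambda>x. K (\<beta> *\<^sub>R R x - x))"
    unfolding generator_ext_def
  proof (rule bounded_extension_eqI)
    show "bounded_linear (\<lambda>x. K (\<beta> *\<^sub>R R x - x))"
      by (intro bounded_linear_compose[OF K_bounded_linear] bounded_linear_sub
          bounded_linear_scaleR_right[THEN bounded_linear_compose] R_bounded_linear bounded_linear_ident)
    show "K (\<beta> *\<^sub>R R x - x) = \<iota> (A x)" if "x \<in> D" for x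
      using R_left[OF that] by (simp flip: K_R add: R.diff R.scaleR) (metis R.diff R.scaleR add_diff_cancel_left' diff_add_cancel)
  qed (simp add: domain_dense)
  then show ?thesis by simp
qed

text \<open>The control operator transported to the state space; it is bounded as a map into \<open>H\<close>.\<close>
definition b :: "'u \<Rightarrow> 'h" where "b v = inv K (B v)"

lemma b_bounded_linear: "bounded_linear b"
  unfolding b_def using bounded_linear_compose[OF inv_K_bounded_linear B_bounded_linear] .

interpretation b: bounded_linear b by (rule b_bounded_linear)

definition steady :: "'h \<Rightarrow> 'u \<Rightarrow> bool" where
  "steady y v \<longleftrightarrow> generator_ext D A \<iota> y + B v = 0"

lemma steady_iff: "steady y v \<longleftrightarrow> A (R y) + b v = 0"
proof -
  have "generator_ext D A \<iota> y + B v = K (A (R y) + b v)"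
    by (simp add: generator_ext_eq A_R b_def K.add)
  then show ?thesis unfolding steady_def using norm_K[of "A (R y) + b v"] by (metis norm_eq_zero)
qed

lemma steady_combination:
  assumes "steady y v" "steady y' v'"
  shows "steady (c *\<^sub>R y + c' *\<^sub>R y') (c *\<^sub>R v + c' *\<^sub>R v')"
proof -
  have "A (R (c *\<^sub>R y + c' *\<^sub>R y')) + b (c *\<^sub>R v + c' *\<^sub>R v')
      = c *\<^sub>R (A (R y) + b v) + c' *\<^sub>R (A (R y') + b v')"
    by (simp add: R.add R.scaleR b.add b.scaleR generator_linear_combination(2)[OF R_domain R_domain] algebra_simps)
  then show ?thesis using assms by (simp add: steady_iff)
qed

text \<open>The variation-of-constants formula for \<open>y(0) = x\<close> and \<open>y(t) = y\<close>, pulled back by \<open>K\<close> to the state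
  space. Stating it with \<open>has_integral\<close> makes existence of the integral part of the
  predicate, which is what superposition and concatenation need.\<close>
definition steers :: "real \<Rightarrow> (real \<Rightarrow> 'u) \<Rightarrow> 'h \<Rightarrow> 'h \<Rightarrow> bool" where
  "steers t u x y \<longleftrightarrow> bounded_measurable u \<and>
     ((\<lambda>r. S (t - r) (b (u r))) has_integral R y - S t (R x)) {0..t}"

lemma steers_imp_mild_solution:
  assumes "0 \<le> t" "steers t u x y"
  shows "mild_solution S \<iota> B x u t = y"
proof -
  have "((\<lambda>r. K (S (t - r) (b (u r)))) has_integral K (R y - S t (R x))) {0..t}"
    using has_integral_linear[OF conjunct2[OF assms(2)[unfolded steers_def]] K_bounded_linear] unfolding o_def .
  then have "((\<lambda>r. semigroup_ext S \<iota> (t - r) (B (u r))) has_integral K (R y - S t (R x))) {0..t}"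
    by (rule has_integral_eq[rotated]) (simp add: semigroup_ext_eq b_def)
  then have "input_map S \<iota> B u t = K (R y - S t (R x))"
    unfolding input_map_def by (rule integral_unique)
  also have "\<dots> = \<iota> y - \<iota> (S t x)" using assms(1) by (simp add: K.diff K_R flip: R_S)
  finally show ?thesis
    unfolding mild_solution_def using \<iota>_eq_iff by simp
qed

text \<open>If continuous functions \<open>g n\<close> converge to \<open>u\<close> almost everywhere, then \<open>r \<mapsto> S (t - r) (b (g n r))\<close>
  is continuous and converges to the integrand, which is therefore strongly measurable. The truncation
  of \<open>t - r\<close> at \<open>0\<close> extends these functions to the whole line.\<close>
lemma response_integrable:
  assumes "0 \<le> t" and u: "bounded_measurable u"
  shows "(\<lambda>r. S (t - r) (b (u r))) integrable_on {0..t}"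
proof -
  obtain N g where N: "negligible N" and cont: "\<And>n. continuous_on UNIV (g n)"
    and lim: "\<And>r. r \<notin> N \<Longrightarrow> (\<lambda>n::nat. g n r) \<longlonglongrightarrow> u r"
    using u unfolding bounded_measurable_def measurable_on_def by auto
  define h where "h r = S (max 0 (t - r)) (b (u r))" for r
  have hm: "h measurable_on UNIV"
    unfolding measurable_on_def
  proof (intro exI conjI allI impI)
    show "continuous_on UNIV (\<lambda>r. S (max 0 (t - r)) (b (g n r)))" for n
      by (intro continuous_on_S b.continuous_on cont continuous_intros) auto
    show "(\<lambda>n. S (max 0 (t - r)) (b (g n r))) \<longlonglongrightarrow> (if r \<in> UNIV then h r else 0)" if "r \<notin> N" for r
      using bounded_linear.tendsto[OF S_linear b.tendsto[OF lim[OF that]], of "max 0 (t - r)"] by (simp add: h_def)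
  qed (rule N)
  have "(\<lambda>r. if r \<in> {0..t} then h r else 0) measurable_on UNIV"
    by (rule measurable_on_restrict[OF hm]) simp
  then have meas: "h measurable_on {0..t}" by (rule iffD1[OF measurable_on_UNIV])
  obtain M where "M > 0" and M: "\<And>r x. 0 \<le> r \<Longrightarrow> r \<le> t \<Longrightarrow> norm (S r x) \<le> M * norm x"
    by (rule S_bounded[of t]) blast
  have "bounded (range (\<lambda>r. b (u r)))"
    using bounded_measurable_linear[OF b_bounded_linear u] by (simp add: bounded_measurable_def)
  then obtain L where L: "\<And>r. norm (b (u r)) \<le> L" by (auto simp: bounded_iff)
  have "h integrable_on {0..t}"
  proof (rule bounded_measurable_integrable[OF meas])
    fix r assume "r \<in> {0..t}"
    then have "norm (h r) \<le> M * norm (b (u r))" using M by (simp add: h_def)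
    also have "\<dots> \<le> M * L" using L \<open>M > 0\<close> by simp
    finally show "norm (h r) \<le> M * L" .
  qed
  then show ?thesis by (rule integrable_eq) (simp add: h_def)
qed

text \<open>Admissibility provides the element of \<open>H\<close> that the definite description in \<open>mild_solution\<close>
  refers to; without it the value of \<open>mild_solution\<close> would carry no information.\<close>
lemma mild_solution_imp_steers:
  assumes "0 < t" and adm: "admissible S \<iota> B" and u: "bounded_measurable u" "u \<in> L2 {0<..}"
    and y: "mild_solution S \<iota> B x u t = y"
  shows "steers t u x y"
proof -
  have int: "((\<lambda>r. S (t - r) (b (u r))) has_integral integral {0..t} (\<lambda>r. S (t - r) (b (u r)))) {0..t}"
    using response_integrable[of t u] u \<open>0 < t\<close> by (simp add: integrable_integral)
  obtain z where z: "input_map S \<iota> B u t = \<iota> z"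
    using adm u(2) \<open>0 < t\<close> by (auto simp: admissible_def)
  have "((\<lambda>r. semigroup_ext S \<iota> (t - r) (B (u r))) has_integral
      K (integral {0..t} (\<lambda>r. S (t - r) (b (u r))))) {0..t}"
    using has_integral_linear[OF int K_bounded_linear]
    by (rule has_integral_eq[rotated]) (simp add: semigroup_ext_eq b_def)
  then have "K (R z) = K (integral {0..t} (\<lambda>r. S (t - r) (b (u r))))"
    using z by (simp add: input_map_def K_R integral_unique)
  then have Rz: "integral {0..t} (\<lambda>r. S (t - r) (b (u r))) = R z" by (metis inv_K)
  have "mild_solution S \<iota> B x u t = S t x + z"
    unfolding mild_solution_def z using \<iota>_eq_iff by (simp flip: linear_add[OF \<iota>_linear])
  then show ?thesis
    using int u(1) y \<open>0 < t\<close> unfolding Rz by (auto simp: steers_def R.add R_S)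
qed

lemma steers_add:
  assumes "steers t u x y" "steers t u' x' y'" "0 \<le> t"
  shows "steers t (\<lambda>r. u r + u' r) (x + x') (y + y')"
proof -
  have "((\<lambda>r. S (t - r) (b (u r)) + S (t - r) (b (u' r))) has_integral
      (R y - S t (R x)) + (R y' - S t (R x'))) {0..t}"
    using assms by (intro has_integral_add) (auto simp: steers_def)
  moreover have "(R y - S t (R x)) + (R y' - S t (R x')) = R (y + y') - S t (R (x + x'))"
    using assms(3) by (simp add: R.add S_plus)
  ultimately have "((\<lambda>r. S (t - r) (b (u r + u' r))) has_integral R (y + y') - S t (R (x + x'))) {0..t}"
    by (simp only:) (rule has_integral_eq[rotated], assumption, simp add: b.add S_plus)
  then show ?thesis using assms by (simp add: steers_def bounded_measurable_add)
qed

lemma steers_scale: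
  assumes "steers t u x y" "0 \<le> t"
  shows "steers t (\<lambda>r. c *\<^sub>R u r) (c *\<^sub>R x) (c *\<^sub>R y)"
proof -
  have "((\<lambda>r. c *\<^sub>R S (t - r) (b (u r))) has_integral c *\<^sub>R (R y - S t (R x))) {0..t}"
    using assms by (intro has_integral_cmul) (auto simp: steers_def)
  moreover have "c *\<^sub>R (R y - S t (R x)) = R (c *\<^sub>R y) - S t (R (c *\<^sub>R x))"
    using assms(2) by (simp add: R.scaleR S_scale scaleR_diff_right)
  ultimately have "((\<lambda>r. S (t - r) (b (c *\<^sub>R u r))) has_integral R (c *\<^sub>R y) - S t (R (c *\<^sub>R x))) {0..t}"
    by (simp only:) (rule has_integral_eq[rotated], assumption, simp add: b.scaleR S_scale)
  then show ?thesis using assms bounded_measurable_linear[OF bounded_linear_scaleR_right, of u c]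
    by (simp add: steers_def)
qed

lemma steers_concat:
  assumes u: "steers p u x y" and v: "steers q v y z" and "0 \<le> p" "0 \<le> q"
  shows "steers (p + q) (\<lambda>t. if t < p then u t else v (t - p)) x z"
proof -
  let ?w = "\<lambda>t. if t < p then u t else v (t - p)"
  have "((\<lambda>r. S q (S (p - r) (b (u r)))) has_integral S q (R y - S p (R x))) {0..p}"
    using has_integral_linear[OF conjunct2[OF u[unfolded steers_def]] S_linear[OF \<open>0 \<le> q\<close>]] unfolding o_def .
  then have 1: "((\<lambda>r. S (p + q - r) (b (?w r))) has_integral S q (R y - S p (R x))) {0..p}"
  proof (rule has_integral_spike[of "{p}", rotated 2])
    show "S (p + q - r) (b (?w r)) = S q (S (p - r) (b (u r)))" if "r \<in> {0..p} - {p}" for r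
    proof -
      have e: "p + q - r = q + (p - r)" by simp
      have "S (p + q - r) (b (u r)) = S q (S (p - r) (b (u r)))"
        unfolding e using that \<open>0 \<le> q\<close> by (intro S_add) auto
      then show ?thesis using that by simp
    qed
  qed simp
  have "((\<lambda>r. S (q - r) (b (v r))) has_integral R z - S q (R y)) {0..q}"
    using v by (simp add: steers_def)
  from has_integral_shift_real_ivl[OF this, of "- p"]
  have "((\<lambda>r. S (q - (r - p)) (b (v (r - p)))) has_integral R z - S q (R y)) {p..p + q}"
    by (simp add: add.commute)
  then have 2: "((\<lambda>r. S (p + q - r) (b (?w r))) has_integral R z - S q (R y)) {p..p + q}"
  proof (rule has_integral_eq[rotated])
    show "S (q - (r - p)) (b (v (r - p))) = S (p + q - r) (b (?w r))" if "r \<in> {p..p + q}" for r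
    proof -
      have e: "q - (r - p) = p + q - r" by simp
      show ?thesis unfolding e using that by simp
    qed
  qed
  from has_integral_combine[OF _ _ 1 2]
  have "((\<lambda>r. S (p + q - r) (b (?w r))) has_integral S q (R y - S p (R x)) + (R z - S q (R y))) {0..p + q}"
    using assms(3,4) by simp
  moreover have "S q (R y - S p (R x)) + (R z - S q (R y)) = R z - S (p + q) (R x)"
    using S_add[of q p "R x"] assms(3,4) by (simp add: S_diff add.commute)
  moreover have "bounded_measurable ?w"
    using bounded_measurable_If[of u "\<lambda>t. v (t - p)" "{..<p}"] u v
    by (simp add: steers_def bounded_measurable_shift)
  ultimately show ?thesis by (simp add: steers_def)
qed

lemma steers_steady:
  assumes "steady y v" "0 \<le> t"
  shows "steers t (\<lambda>_. v) y y"
proof -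
  have bv: "b v = - A (R y)" using assms(1) by (simp add: steady_iff eq_neg_iff_add_eq_0 add.commute)
  have "((\<lambda>r. - S (t - r) (A (R y))) has_integral - (S t (R y) - R y)) {0..t}"
    by (intro has_integral_neg orbit_has_integral R_domain assms)
  then have "((\<lambda>r. S (t - r) (b v)) has_integral - (S t (R y) - R y)) {0..t}"
    by (rule has_integral_eq[rotated]) (simp add: bv linear_neg[OF bounded_linear.linear[OF S_linear]])
  then show ?thesis by (simp add: steers_def bounded_measurable_const)
qed

end

section \<open>Steering between steady states\<close>

text \<open>The polynomial \<open>(r (1 - r))\<^sup>k\<close> is positive inside the unit interval, so it can be normalized to
  have integral \<open>1\<close>; \<open>Q\<close> is the primitive of the result, and is monotone.\<close>
lemma smooth_cutoff:
  obtains p :: "real poly" and Q :: "real \<Rightarrow> real"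
  where "([:0, 1:] * [:1, -1:]) ^ k dvd p" "Q 0 = 0" "Q 1 = 1"
    "\<And>r. r \<in> {0..1} \<Longrightarrow> Q r \<in> {0..1}"
    "\<And>r. r \<in> {0..1} \<Longrightarrow> (Q has_real_derivative poly p r) (at r within {0..1})"
proof -
  define m :: "real poly" where "m = ([:0, 1:] * [:1, -1:]) ^ k"
  have m: "poly m r = (r * (1 - r)) ^ k" for r by (simp add: m_def poly_power algebra_simps)
  have cont: "continuous_on X (poly q)" for X and q :: "real poly"
    using continuous_on_poly[OF continuous_on_id] by simp
  have m_nonneg: "poly m r \<ge> 0" if "r \<in> {0..1}" for r using that by (simp add: m)
  define c where "c = integral {0..1} (poly m)"
  have "c \<ge> 0" unfolding c_def by (intro integral_nonneg integrable_continuous_real cont m_nonneg) auto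
  moreover have "c \<noteq> 0"
  proof
    assume "c = 0"
    then have "\<forall>r\<in>{0..1}. poly m r = 0"
      using integral_eq_0_iff[of 0 1 "poly m"] cont m_nonneg by (simp add: c_def)
    then have "poly m (1 / 2) = 0" by simp
    then show False by (simp add: m)
  qed
  ultimately have "c > 0" by simp
  define p where "p = smult (1 / c) m"
  define Q where "Q r = integral {0..r} (poly p)" for r
  have p_nonneg: "poly p r \<ge> 0" if "r \<in> {0..1}" for r using m_nonneg[OF that] \<open>c > 0\<close> by (simp add: p_def)
  have int: "poly p integrable_on {0..r}" for r by (intro integrable_continuous_real cont)
  have "poly p = (\<lambda>r. (1 / c) * poly m r)" by (simp add: p_def fun_eq_iff)
  then have "Q 1 = (1 / c) * c" unfolding Q_def by (simp only: integral_mult_right c_def)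
  then have "Q 1 = 1" using \<open>c > 0\<close> by simp
  show thesis
  proof (rule that[of p Q])
    show "([:0, 1:] * [:1, -1:]) ^ k dvd p" unfolding p_def m_def[symmetric] by (rule dvd_smult) simp
    show "Q r \<in> {0..1}" if r: "r \<in> {0..1}" for r
    proof -
      have "Q r \<ge> 0" unfolding Q_def using p_nonneg r by (intro integral_nonneg int) auto
      moreover have "Q r \<le> Q 1"
        unfolding Q_def using p_nonneg r by (intro integral_subset_le int) auto
      ultimately show ?thesis using \<open>Q 1 = 1\<close> by simp
    qed
    show "(Q has_real_derivative poly p r) (at r within {0..1})" if "r \<in> {0..1}" for r
      unfolding Q_def by (rule integral_has_real_derivative[OF cont that])
  qed (simp_all add: Q_def \<open>Q 1 = 1\<close>[unfolded Q_def])
qed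

text \<open>The control is \<open>\<rho>(t) d\<close> with \<open>\<rho>(t) = Q (1 - t)\<close>. Since \<open>b d = - A (R x)\<close>, its response is minus the
  integral of \<open>Q(r) S(r) A (R x)\<close>, which by parts equals \<open>R z - S(1) (R x)\<close> for the average \<open>z\<close> of the
  orbit of \<open>x\<close> with weight \<open>Q'\<close>. The values of \<open>\<rho>\<close> in the unit interval later keep the controls on a
  segment.\<close>
lemma (in extrapolated_system) smoothing_control:
  assumes "steady x d"
  obtains \<rho> z where "\<And>t. \<rho> t \<in> {0..1::real}" "z \<in> domain_power D A k" "steers 1 (\<lambda>t. \<rho> t *\<^sub>R d) x z"
proof -
  interpret R: bounded_linear R by (rule R_bounded_linear)
  interpret b: bounded_linear b by (rule b_bounded_linear)
  obtain p Q where p: "([:0, 1:] * [:1, -1:]) ^ k dvd p" and Q: "Q 0 = 0" "Q 1 = 1"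
    and Q01: "\<And>r. r \<in> {0..1} \<Longrightarrow> Q r \<in> {0..1}"
    and deriv: "\<And>r. r \<in> {0..1} \<Longrightarrow> (Q has_real_derivative poly p r) (at r within {0..1})"
    by (rule smooth_cutoff) blast
  have contp: "continuous_on {0..1} (poly p)" using continuous_on_poly[OF continuous_on_id] by simp
  have contQ: "continuous_on {0..1} Q" using deriv by (intro DERIV_continuous_on) blast
  \<comment> \<open>Clipping makes \<open>\<rho>\<close> continuous, with values in the unit interval, on the whole line.\<close>
  define \<rho> where "\<rho> t = Q (max 0 (min 1 (1 - t)))" for t
  define z where "z = integral {0..1} (\<lambda>r. poly p r *\<^sub>R S r x)"
  have \<rho>01: "\<rho> t \<in> {0..1}" for t unfolding \<rho>_def by (intro Q01) auto
  have "continuous_on UNIV \<rho>"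
    unfolding \<rho>_def by (intro continuous_on_compose2[OF contQ] continuous_intros) auto
  then have "bounded_measurable (\<lambda>t. \<rho> t *\<^sub>R d)"
    unfolding bounded_measurable_def
  proof (intro conjI continuous_imp_measurable_on continuous_intros)
    have "norm (\<rho> t *\<^sub>R d) \<le> 1 * norm d" for t
      using \<rho>01[of t] mult_right_mono[of "\<rho> t" 1 "norm d"] by simp
    then show "bounded (range (\<lambda>t. \<rho> t *\<^sub>R d))" by (auto simp: bounded_iff)
  qed
  moreover have "((\<lambda>r. S (1 - r) (b (\<rho> r *\<^sub>R d))) has_integral R z - S 1 (R x)) {0..1}"
  proof -
    have "((\<lambda>r. Q r *\<^sub>R S r (A (R x))) has_integral S 1 (R x) - R z) {0..1}"
      using integral_by_parts_orbit[OF R_domain _ deriv contp, of x] Q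
      by (simp add: R_weighted_orbit_integral[OF contp] z_def)
    from has_integral_neg[OF has_integral_reverse[OF this]]
    have "((\<lambda>r. - (Q (1 - r) *\<^sub>R S (1 - r) (A (R x)))) has_integral R z - S 1 (R x)) {0..1}" by simp
    then show ?thesis
    proof (rule has_integral_eq[rotated])
      fix r :: real assume r: "r \<in> {0..1}"
      have "b d = - A (R x)" using assms by (simp add: steady_iff eq_neg_iff_add_eq_0 add.commute)
      moreover have "\<rho> r = Q (1 - r)" using r by (simp add: \<rho>_def)
      ultimately show "- (Q (1 - r) *\<^sub>R S (1 - r) (A (R x))) = S (1 - r) (b (\<rho> r *\<^sub>R d))"
        using r by (simp add: b.scaleR S_scale linear_neg[OF bounded_linear.linear[OF S_linear]])
    qed
  qed
  ultimately have "steers 1 (\<lambda>t. \<rho> t *\<^sub>R d) x z" by (simp add: steers_def)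
  then show thesis
    by (rule that[OF \<rho>01, rotated]) (unfold z_def, rule polynomial_smoothing[OF p])
qed

text \<open>Redefining the control on a null set and switching it off outside the time interval leaves the
  input integral unchanged, and yields a square integrable control on the half-line, to which
  admissibility applies.\<close>
lemma (in extrapolated_system) smooth_null_control:
  assumes adm: "admissible S \<iota> B" and j: "bounded_linear j" and "T > 0"
    and ctrl: "smoothly_controllable A D S \<iota> B j s T" and z: "z \<in> domain_power D A s"
  obtains w where "bounded_measurable w" "steers T (\<lambda>t. j (w t)) z 0"
proof -
  interpret j: bounded_linear j by (rule j)
  obtain v where v: "v \<in> Linf {0<..<T}" "mild_solution S \<iota> B z (\<lambda>t. j (v t)) T = 0"
    using ctrl z unfolding smoothly_controllable_def by blast
  obtain w N where w: "bounded_measurable w" "negligible N"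
    "\<And>t. t \<in> {0<..<T} \<Longrightarrow> t \<notin> N \<Longrightarrow> w t = v t" "\<And>t. t \<notin> {0<..<T} \<Longrightarrow> w t = 0"
    by (rule Linf_representative[OF v(1)]) auto
  have bm: "bounded_measurable (\<lambda>t. j (w t))" by (rule bounded_measurable_linear[OF j w(1)])
  have L2: "(\<lambda>t. j (w t)) \<in> L2 {0<..}"
    by (rule bounded_measurable_L2[OF bm, of _ "{0<..<T}"]) (use w(4) in \<open>auto simp: j.zero\<close>)
  have "negligible (N \<union> {0, T})" using w(2) by simp
  then have "input_map S \<iota> B (\<lambda>t. j (v t)) T = input_map S \<iota> B (\<lambda>t. j (w t)) T"
    unfolding input_map_def by (rule integral_spike) (use w(3) in auto)
  then have "mild_solution S \<iota> B z (\<lambda>t. j (w t)) T = 0"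
    using v(2) by (simp add: mild_solution_def)
  then show thesis
    by (intro that[OF w(1)] mild_solution_imp_steers[OF \<open>T > 0\<close> adm bm L2])
qed

lemma convex_cone_add:
  assumes "convex U" "cone U" "x \<in> U" "y \<in> U"
  shows "x + y \<in> U"
  using assms convex_cone[of U] by blast

text \<open>The states \<open>Y k\<close> divide the segment from \<open>y0\<close> to \<open>y1\<close> equally. On each step the constant control of the
  endpoint \<open>Y (k + 1)\<close> is superimposed with \<open>1 / n\<close> times the control that drives \<open>y0 - y1\<close> to \<open>0\<close>. The margin
  \<open>r\<close> at both ends is inherited by the whole segment through convexity, and \<open>n\<close> is chosen such that the
  contribution of \<open>w\<close> stays within it.\<close>
lemma (in extrapolated_system) steer_along_segment:
  assumes U: "convex U" and "0 < r" "T > 1"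
    and adm0: "\<And>v. norm v < r \<Longrightarrow> u0 + j v \<in> U" and adm1: "\<And>v. norm v < r \<Longrightarrow> u1 + j v \<in> U"
    and j: "bounded_linear j"
    and st: "steady y0 u0" "steady y1 u1"
    and w: "bounded_measurable w" and \<rho>: "\<And>t. \<rho> t \<in> {0..1::real}"
    and c: "steers T (\<lambda>t. if t < 1 then \<rho> t *\<^sub>R (u0 - u1) else j (w (t - 1))) (y0 - y1) 0"
  shows "\<exists>n u. n > 0 \<and> (\<forall>t. u t \<in> U) \<and> steers (real n * T) u y0 y1"
proof -
  interpret j: bounded_linear j by (rule j)
  let ?c = "\<lambda>t. if t < 1 then \<rho> t *\<^sub>R (u0 - u1) else j (w (t - 1))"
  obtain M where M: "\<And>t. norm (w t) \<le> M"
    using w by (auto simp: bounded_measurable_def bounded_iff)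
  obtain n :: nat where n: "real n > max 0 (M / r)" using reals_Archimedean2 by blast
  then have "n > 0" by auto
  have small: "norm ((1 / real n) *\<^sub>R w t) < r" for t
  proof -
    have "norm (w t) < r * real n" using M[of t] n \<open>r > 0\<close> by (simp add: field_simps)
    then show ?thesis using \<open>n > 0\<close> by (simp add: field_simps)
  qed
  define Y where "Y k = y0 + (real k / real n) *\<^sub>R (y1 - y0)" for k
  define V where "V l = u0 + l *\<^sub>R (u1 - u0)" for l :: real
  have V_in: "V l + j v \<in> U" if "l \<in> {0..1}" "norm v < r" for l v
  proof -
    have "V l + j v = (1 - l) *\<^sub>R (u0 + j v) + l *\<^sub>R (u1 + j v)" by (simp add: V_def algebra_simps)
    then show ?thesis using convexD[OF U adm0[OF that(2)] adm1[OF that(2)], of "1 - l" l] that(1) by simp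
  qed
  have V_in0: "V l \<in> U" if "l \<in> {0..1}" for l using V_in[OF that, of 0] \<open>r > 0\<close> by (simp add: j.zero)
  have "\<exists>u. (\<forall>t. u t \<in> U) \<and> steers (real k * T) u y0 (Y k)" if "k \<le> n" for k
    using that
  proof (induction k)
    case 0
    have "steers 0 (\<lambda>_. u0) y0 y0" using st(1) by (rule steers_steady) simp
    then show ?case using V_in0[of 0] by (intro exI[of _ "\<lambda>_. u0"]) (simp add: Y_def V_def)
  next
    case (Suc k)
    then obtain u where u: "\<And>t. u t \<in> U" "steers (real k * T) u y0 (Y k)" by auto
    let ?l = "real (Suc k) / real n"
    let ?u = "\<lambda>t. V ?l + (1 / real n) *\<^sub>R ?c t"
    have "steady (Y (Suc k)) (V ?l)"
      using steady_combination[OF st, of "1 - ?l" ?l] by (simp add: Y_def V_def algebra_simps)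
    then have "steers T ?u (Y (Suc k) + (1 / real n) *\<^sub>R (y0 - y1)) (Y (Suc k) + (1 / real n) *\<^sub>R 0)"
      using \<open>T > 1\<close> by (intro steers_add steers_scale c steers_steady) auto
    moreover have "Y (Suc k) + (1 / real n) *\<^sub>R (y0 - y1) = Y k"
      by (simp add: Y_def add_divide_distrib algebra_simps)
    ultimately have step: "steers T ?u (Y k) (Y (Suc k))" by simp
    have u_in: "?u t \<in> U" for t
    proof (cases "t < 1")
      case True
      \<comment> \<open>The first phase slides along the segment from the control of \<open>Y k\<close> to that of \<open>Y (k + 1)\<close>.\<close>
      have "?u t = V ((real (Suc k) - \<rho> t) / real n)"
        using True by (simp add: V_def diff_divide_distrib algebra_simps)
      moreover have "(real (Suc k) - \<rho> t) / real n \<in> {0..1}"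
        using \<rho>[of t] Suc.prems \<open>n > 0\<close> by (auto simp: field_simps)
      ultimately show ?thesis using V_in0 by simp
    next
      case False
      then show ?thesis
        using V_in[OF _ small[of "t - 1"], of ?l] Suc.prems \<open>n > 0\<close> by (simp add: j.scaleR)
    qed
    have "steers (real k * T + T) (\<lambda>t. if t < real k * T then u t else ?u (t - real k * T)) y0 (Y (Suc k))"
      using \<open>T > 1\<close> by (intro steers_concat[OF u(2) step]) auto
    moreover have "real k * T + T = real (Suc k) * T" by (simp add: algebra_simps)
    ultimately show ?case
      using u(1) u_in by (intro exI[of _ "\<lambda>t. if t < real k * T then u t else ?u (t - real k * T)"]) auto
  qed
  moreover have "Y n = y1" using \<open>n > 0\<close> by (simp add: Y_def)
  ultimately show ?thesis using \<open>n > 0\<close> by blast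
qed

theorem theorem2p4:
  fixes D :: "'h::{real_inner, banach} set"
    and A :: "'h \<Rightarrow> 'h"
    and S :: "real \<Rightarrow> 'h \<Rightarrow> 'h"
    and \<beta> :: real
    and \<iota> :: "'h \<Rightarrow> 'm::banach"
    and B :: "'u::{real_inner, banach} \<Rightarrow> 'm"
    and j :: "'v::{real_inner, banach} \<Rightarrow> 'u"
    and s :: nat
    and T0 :: real
    and Uad :: "'u set"
    and W :: "'u set"
    and y0 y1 :: 'h
    and u0 u1 :: 'u
  assumes "generates D A S"
    and "in_resolvent_set D A \<beta>"
    and "extrapolation_space D A \<beta> \<iota>"
    and "bounded_linear B"
    and "admissible S \<iota> B"
    and "bounded_linear j" and "inj j"
    and H1: "T0 > 0" "smoothly_controllable A D S \<iota> B j s T0"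
    and H2: "closed Uad" "convex Uad" "cone Uad" "interior (j -` Uad) \<noteq> {}"
    and W_def: "W = {j w + a | w a. w \<in> interior (j -` Uad) \<and> a \<in> Uad}"
    and "u0 \<in> W" and "u1 \<in> W"
    and "generator_ext D A \<iota> y0 + B u0 = 0"
    and "generator_ext D A \<iota> y1 + B u1 = 0"
  shows "\<exists>T>T0. \<exists>u\<in>L2 {0<..<T}.
           (AE t in lebesgue_on {0<..<T}. u t \<in> Uad) \<and>
           mild_solution S \<iota> B y0 u T = y1"
proof -
  interpret extrapolated_system D A S \<beta> \<iota> B
    by (intro extrapolated_system.intro resolvent_semigroup.intro semigroup_generator.intro
        resolvent_semigroup_axioms.intro extrapolated_system_axioms.intro) fact+
  interpret j: bounded_linear j by fact
  have st: "steady y0 u0" "steady y1 u1" using assms by (auto simp: steady_def)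
  \<comment> \<open>The decomposition \<open>u = j w + a\<close> provides room around \<open>j w\<close> in the smooth directions, and adding \<open>a\<close>
    keeps it inside the cone.\<close>
  have margin: "\<exists>r>0. \<forall>v. norm v < r \<longrightarrow> u + j v \<in> Uad" if uW: "u \<in> W" for u
  proof -
    obtain w a where u: "u = j w + a" "w \<in> interior (j -` Uad)" "a \<in> Uad"
      using uW[unfolded W_def, THEN CollectD] by (elim exE conjE) (rule that)
    then obtain r where r: "r > 0" "ball w r \<subseteq> j -` Uad" by (auto simp: mem_interior)
    have "u + j v \<in> Uad" if "norm v < r" for v
    proof -
      have "w + v \<in> ball w r" using that by (simp add: dist_norm)
      then have "j (w + v) + a \<in> Uad" using r u(3) H2 by (intro convex_cone_add) auto
      then show ?thesis by (simp add: u(1) j.add add_ac)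
    qed
    with r(1) show ?thesis by (intro exI[of _ r]) simp
  qed
  obtain r0 where r0: "r0 > 0" "\<forall>v. norm v < r0 \<longrightarrow> u0 + j v \<in> Uad"
    using margin[OF \<open>u0 \<in> W\<close>] by (elim exE conjE)
  obtain r1 where r1: "r1 > 0" "\<forall>v. norm v < r1 \<longrightarrow> u1 + j v \<in> Uad"
    using margin[OF \<open>u1 \<in> W\<close>] by (elim exE conjE)
  have r: "min r0 r1 > 0" "\<And>v. norm v < min r0 r1 \<Longrightarrow> u0 + j v \<in> Uad"
    "\<And>v. norm v < min r0 r1 \<Longrightarrow> u1 + j v \<in> Uad" using r0 r1 by simp_all
  have "steady (y0 - y1) (u0 - u1)" using steady_combination[OF st, of 1 "-1"] by simp
  then obtain \<rho> z where \<rho>: "\<And>t. \<rho> t \<in> {0..1::real}" and z: "z \<in> domain_power D A s"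
    and smooth: "steers 1 (\<lambda>t. \<rho> t *\<^sub>R (u0 - u1)) (y0 - y1) z"
    by (rule smoothing_control) blast
  obtain w where w: "bounded_measurable w" and ctrl: "steers T0 (\<lambda>t. j (w t)) z 0"
    by (rule smooth_null_control[OF \<open>admissible S \<iota> B\<close> \<open>bounded_linear j\<close> H1 z]) blast
  have steer: "steers (1 + T0) (\<lambda>t. if t < 1 then \<rho> t *\<^sub>R (u0 - u1) else j (w (t - 1))) (y0 - y1) 0"
    by (rule steers_concat[OF smooth ctrl]) (use H1(1) in auto)
  have "\<exists>n u. n > 0 \<and> (\<forall>t. u t \<in> Uad) \<and> steers (real n * (1 + T0)) u y0 y1"
    by (rule steer_along_segment[OF H2(2) r(1) _ r(2,3) j.bounded_linear_axioms st w \<rho> steer])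
       (use H1(1) in auto)
  then obtain n u where n: "n > 0" and u: "\<forall>t. u t \<in> Uad" "steers (real n * (1 + T0)) u y0 y1"
    by blast
  define T where "T = real n * (1 + T0)"
  have "1 * (1 + T0) \<le> T" unfolding T_def using n H1(1) by (intro mult_right_mono) auto
  then have T: "T > T0" by simp
  have "u \<in> L2 {0<..<T}"
    using u(2) by (intro bounded_measurable_L2[of _ _ "{0<..<T}"]) (auto simp: steers_def)
  moreover have "mild_solution S \<iota> B y0 u T = y1"
    using u(2) T H1(1) by (intro steers_imp_mild_solution) (auto simp: T_def)
  moreover have "AE t in lebesgue_on {0<..<T}. u t \<in> Uad" using u(1) by simp
  ultimately show ?thesis using T by blast
qed

end
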